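(* Let $m\ge1$, $1\leq p<2$, and let $\omega$ be a continuous nondecreasing function on $[0,+\infty)$ with $\omega(0)=0$; let $\chi(\delta)=\delta\omega(\delta)$ and let $\chi^{-1}$ be its inverse function. Let $V$ be a domain in $\mathbb R^m$ and let $\varphi\in C^{1,\omega}(V)$ be a real function such that $\nabla\varphi(V)$ has positive Lebesgue measure. Then there is $c>0$ independent of $\lambda$ such that $$\|e^{i\lambda\varphi}\|_{A_p(\mathbb R^m,V)}\geq c\Big(|\lambda|^{1/p}\chi^{-1}\Big(\frac1{|\lambda|}\Big)\Big)^m$$ for all $\lambda\in\mathbb R$ with $|\lambda|\geq1$ for which $e^{i\lambda\varphi}\in A_p(\mathbb R^m,V)$.
   Context: The Fourier transform on $\mathbb R^m$ is normalized by $\widehat f(u)=(2\pi)^{-m}\int_{\mathbb R^m}f(t)e^{-i(u,t)}dt$ for $f\in L^1(\mathbb R^m)$ (extended to tempered distributions). For $1\le p\le\infty$, $A_p(\mathbb R^m)$ is the space of tempered distributions $f$ on $\mathbb R^m$ with $\widehat f\in L^p(\mathbb R^m)$, $\|f\|_{A_p(\mathbb R^m)}=\|\widehat f\|_{L^p(\mathbb R^m)}$ (for $p=1$, $f$ is taken continuous). For a set $E\subseteq\mathbb R^m$, a function $f$ on $E$ belongs to $A_p(\mathbb R^m,E)$ if there is $F\in A_p(\mathbb R^m)$ with $F|_E=f$; $\|f\|_{A_p(\mathbb R^m,E)}=\inf\{\|F\|_{A_p(\mathbb R^m)}:F|_E=f\}$. For a domain $V$ and $g$ on $V$, $\omega(V,g,\delta)=\sup\{|g(t_1)-g(t_2)|:t_1,t_2\in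 V,|t_1-t_2|\le\delta\}$; $C^{1,\omega}(V)$ is the class of functions on $V$ whose first-order partial derivatives $g$ satisfy $\omega(V,g,\delta)=O(\omega(\delta))$ as $\delta\to+0$. *)

theory Defs
  imports "HOL-Analysis.Analysis"
begin

fun pderivs :: "'a::euclidean_space list \<Rightarrow> ('a \<Rightarrow> 'b::real_normed_vector) \<Rightarrow> 'a \<Rightarrow> 'b" where
  "pderivs [] f = f"
| "pderivs (i # is) f = (\<lambda>x. frechet_derivative (pderivs is f) (at x) i)"

definition schwartz :: "('a::euclidean_space \<Rightarrow> complex) set" where
  "schwartz = {\<psi>. \<forall>is. set is \<subseteq> Basis \<longrightarrow>
      (\<forall>x. pderivs is \<psi> differentiable (at x)) \<and>
      (\<forall>N::nat. bounded (range (\<lambda>x. ((1 + norm x) ^ N) *\<^sub>R pderivs is \<psi> x)))}"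

definition fourier :: "('a::euclidean_space \<Rightarrow> complex) \<Rightarrow> 'a \<Rightarrow> complex" where
  "fourier f u = complex_of_real ((2 * pi) powr (- real DIM('a))) *
      (LINT t|lborel. f t * cis (- (u \<bullet> t)))"

definition Lp_norm :: "real \<Rightarrow> ('a::euclidean_space \<Rightarrow> complex) \<Rightarrow> real" where
  "Lp_norm p g = (LINT u|lborel. norm (g u) powr p) powr (1 / p)"

text \<open>F is (a function representing) an element of A_p with Fourier transform g in L^p:
  F is a tempered distribution (integrable against all Schwartz functions) and
  its distributional Fourier transform equals g.\<close>
definition Ap_repr :: "real \<Rightarrow> ('a::euclidean_space \<Rightarrow> complex) \<Rightarrow> ('a \<Rightarrow> complex) \<Rightarrow> bool" where
  "Ap_repr p F g \<longleftrightarrow>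
     g \<in> borel_measurable lborel \<and> integrable lborel (\<lambda>u. norm (g u) powr p) \<and>
     F \<in> borel_measurable lborel \<and> (p = 1 \<longrightarrow> continuous_on UNIV F) \<and>
     (\<forall>\<psi>\<in>schwartz. integrable lborel (\<lambda>t. F t * \<psi> t)) \<and>
     (\<forall>\<psi>\<in>schwartz. (LINT t|lborel. F t * fourier \<psi> t) = (LINT u|lborel. g u * \<psi> u))"

definition in_Ap_restr :: "real \<Rightarrow> 'a::euclidean_space set \<Rightarrow> ('a \<Rightarrow> complex) \<Rightarrow> bool" where
  "in_Ap_restr p E f \<longleftrightarrow> (\<exists>F g. Ap_repr p F g \<and> (\<forall>t\<in>E. F t = f t))"

definition Ap_restr_norm :: "real \<Rightarrow> 'a::euclidean_space set \<Rightarrow> ('a \<Rightarrow> complex) \<Rightarrow> real" where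
  "Ap_restr_norm p E f = Inf {Lp_norm p g | F g. Ap_repr p F g \<and> (\<forall>t\<in>E. F t = f t)}"

definition gradient :: "('a::euclidean_space \<Rightarrow> real) \<Rightarrow> 'a \<Rightarrow> 'a" where
  "gradient \<phi> t = (\<Sum>i\<in>Basis. frechet_derivative \<phi> (at t) i *\<^sub>R i)"

definition C1_omega :: "(real \<Rightarrow> real) \<Rightarrow> 'a::euclidean_space set \<Rightarrow> ('a \<Rightarrow> real) \<Rightarrow> bool" where
  "C1_omega \<omega> V \<phi> \<longleftrightarrow> \<phi> differentiable_on V \<and>
     (\<forall>i\<in>Basis. \<exists>C \<delta>0. \<delta>0 > 0 \<and> (\<forall>\<delta>. 0 < \<delta> \<and> \<delta> \<le> \<delta>0 \<longrightarrow>
        (\<forall>t1\<in>V. \<forall>t2\<in>V. dist t1 t2 \<le> \<delta> \<longrightarrow>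
          \<bar>frechet_derivative \<phi> (at t1) i - frechet_derivative \<phi> (at t2) i\<bar> \<le> C * \<omega> \<delta>)))"

definition chi_inv :: "(real \<Rightarrow> real) \<Rightarrow> real \<Rightarrow> real" where
  "chi_inv \<omega> = the_inv_into {0..} (\<lambda>d. d * \<omega> d)"

end

(* Replace phi near t0 by its linear part: on a ball of radius r comparable to
   delta = chi_inv (1/|lam|) the error is O(1/|lam|), so there exp(i lam phi) is essentially the
   character of frequency lam grad phi(t0).  Hence pairing any extension F with a bump at scale r,
   modulated by that character, gives at least a multiple of r^m.  On the Fourier side the pairing
   is a convolution of |F^| with a kernel of bounded L^1 norm, so |F^| * kernel is at least a multiple
   of r^m at every point of lam grad phi(V), a set of measure comparable to |lam|^m; taking L^p
   norms gives the bound.  The bump is a product of (1 - x^2)_+ and not smooth; to use it as a test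
   function F is first mollified by Gaussians, the only Schwartz functions needed. *)
theory Submission
  imports Defs "HOL-Probability.Characteristic_Functions" "HOL-Probability.Sinc_Integral" "HOL-Real_Asymp.Real_Asymp"
begin

text \<open>\<open>Ap_repr\<close> reaches \<open>F\<close> only through pairings with Schwartz
  functions, and for p > 1 the transform \<open>g\<close> need not be integrable, so there is no
  inversion formula to start from. A Gaussian damping factor makes \<open>g\<close> integrable and
  is removed again by letting the width tend to 0. The profile 1 - x^2 is the simplest that vanishes
  at both ends of [-1,1]: its transform decays quadratically, so the product over the coordinates is
  integrable, and it has an elementary antiderivative against exponentials. The radius
  \<open>chi_inv \<omega> (1 / \<bar>lam\<bar>)\<close> is the one at which the linearization error
  \<delta> \<omega>(\<delta>) equals 1/|lam|. The exponents arise as follows. For each gradient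
  value s the kernel average of |g| around lam s is at least a constant times r^m. The kernel has
  mass independent of r and lam, so a convexity argument bounds the average of |g|^p from below by a
  constant times r^(mp). Integrating over s exchanges the roles of the variables, and at each
  frequency v the kernel has mass of order |lam|^(-m) in s. Hence r^(mp) |lam|^m is at most a
  constant times the p-th power of the norm of \<open>g\<close>, and a p-th root finishes.\<close>

section \<open>Integration over coordinates and under affine maps\<close>

lemma
  fixes f :: "'a::euclidean_space \<Rightarrow> real \<Rightarrow> 'b::{real_normed_field,banach,second_countable_topology}"
  assumes int: "\<And>i. i \<in> Basis \<Longrightarrow> integrable lborel (f i)"
  shows integrable_lborel_prod: "integrable lborel (\<lambda>x::'a. \<Prod>i\<in>Basis. f i (x \<bullet> i))"
    and integral_lborel_prod:
      "(LINT x|lborel. (\<Prod>i\<in>Basis. f i ((x::'a) \<bullet> i))) = (\<Prod>i\<in>Basis. (LINT y|lborel. f i y))"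
proof -
  interpret product_sigma_finite "\<lambda>_::'a. lborel :: real measure" by standard
  have [measurable]: "i \<in> Basis \<Longrightarrow> f i \<in> borel_measurable borel" for i
    using borel_measurable_integrable[OF int, of i] by simp
  show "integrable lborel (\<lambda>x::'a. \<Prod>i\<in>Basis. f i (x \<bullet> i))"
    unfolding lborel_eq[where 'a='a]
    using product_integrable_prod[OF finite_Basis int] by (subst integrable_distr_eq) auto
  show "(LINT x|lborel. (\<Prod>i\<in>Basis. f i ((x::'a) \<bullet> i))) = (\<Prod>i\<in>Basis. (LINT y|lborel. f i y))"
    unfolding lborel_eq[where 'a='a]
    using product_integral_prod[OF finite_Basis int] by (subst integral_distr) auto
qed

lemma nn_integral_lborel_affine:
  fixes f :: "'a::euclidean_space \<Rightarrow> ennreal"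
  assumes [measurable]: "f \<in> borel_measurable borel" and "c \<noteq> 0"
  shows "(\<integral>\<^sup>+x. f x \<partial>lborel) = ennreal (\<bar>c\<bar> ^ DIM('a)) * (\<integral>\<^sup>+x. f (t + c *\<^sub>R x) \<partial>lborel)"
  by (subst lborel_affine[OF \<open>c \<noteq> 0\<close>, of t])
    (simp add: nn_integral_density nn_integral_distr nn_integral_cmult)

lemma integral_lborel_affine:
  fixes f :: "'a::euclidean_space \<Rightarrow> 'b::{banach,second_countable_topology}"
  assumes [measurable]: "f \<in> borel_measurable borel" and "c \<noteq> 0"
  shows "(LINT x|lborel. f x) = \<bar>c\<bar> ^ DIM('a) *\<^sub>R (LINT x|lborel. f (t + c *\<^sub>R x))"
  by (subst lborel_affine[OF \<open>c \<noteq> 0\<close>, of t]) (simp add: integral_density integral_distr)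

lemma integrable_lborel_affine:
  fixes f :: "'a::euclidean_space \<Rightarrow> 'b::{banach,second_countable_topology}"
  assumes "integrable lborel f" and "c \<noteq> 0"
  shows "integrable lborel (\<lambda>x. f (t + c *\<^sub>R x))"
proof -
  have [measurable]: "f \<in> borel_measurable borel"
    using borel_measurable_integrable[OF assms(1)] by simp
  have "integrable (density (distr lborel borel (\<lambda>x. t + c *\<^sub>R x)) (\<lambda>_. \<bar>c\<bar> ^ DIM('a))) f"
    using assms(1) lborel_affine[OF \<open>c \<noteq> 0\<close>, of t] by simp
  then have "integrable lborel (\<lambda>x. \<bar>c\<bar> ^ DIM('a) *\<^sub>R f (t + c *\<^sub>R x))"
    by (simp add: integrable_density integrable_distr_eq)
  then have "integrable lborel (\<lambda>x. (1 / \<bar>c\<bar> ^ DIM('a)) *\<^sub>R \<bar>c\<bar> ^ DIM('a) *\<^sub>R f (t + c *\<^sub>R x))"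
    by (rule integrable_scaleR_right)
  then show ?thesis
    using \<open>c \<noteq> 0\<close> by simp
qed

section \<open>Gaussians, their Fourier integrals and the heat kernel\<close>

lemma measurable_cis [measurable]: "cis \<in> borel_measurable borel"
  by (intro borel_measurable_continuous_onI continuous_intros)

text \<open>This is the characteristic function of the standard normal distribution after the
  substitution \<open>y = e * v\<close>.\<close>

lemma gaussian_fourier_real:
  fixes e x :: real
  assumes "e > 0"
  shows "integrable lborel (\<lambda>v. complex_of_real (exp (- (e\<^sup>2 * v\<^sup>2) / 2)) * cis (v * x))" (is ?i)
    and "(LINT v|lborel. complex_of_real (exp (- (e\<^sup>2 * v\<^sup>2) / 2)) * cis (v * x)) =
      complex_of_real (sqrt (2 * pi) / e * exp (- (x\<^sup>2) / (2 * e\<^sup>2)))" (is ?I)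
proof -
  let ?f = "\<lambda>y. complex_of_real (std_normal_density y) * cis (y * (x / e))"
  have int: "integrable lborel ?f"
    by (rule Bochner_Integration.integrable_bound[OF integrable_std_normal_moment[of 0]])
       (auto simp: norm_mult)
  have val: "(LINT y|lborel. ?f y) = exp (- ((x / e)\<^sup>2) / 2)"
    using fun_cong[OF char_std_normal_distribution, of "x / e"]
    by (simp add: char_def integral_density cis_conv_exp mult_ac scaleR_conv_of_real)
  \<comment> \<open>The argument is written \<open>0 + e * v\<close> to match the shape t + c x of
    the affine substitution rules.\<close>
  have eq: "?f (0 + e * v) = of_real (1 / sqrt (2 * pi)) *
      (complex_of_real (exp (- (e\<^sup>2 * v\<^sup>2) / 2)) * cis (v * x))" for v
    using assms by (simp add: std_normal_density_def power_mult_distrib)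
  have "integrable lborel (\<lambda>v. ?f (0 + e * v))"
    using lborel_integrable_real_affine[OF int, of e 0] assms by simp
  then have "integrable lborel (\<lambda>v. of_real (sqrt (2 * pi)) * ?f (0 + e * v))"
    by (rule integrable_mult_right)
  then show ?i
    unfolding eq by simp
  have "(LINT y|lborel. ?f y) = e *\<^sub>R (LINT v|lborel. ?f (0 + e * v))"
    using lborel_integral_real_affine[of e ?f 0] assms by simp
  then have "exp (- ((x / e)\<^sup>2) / 2) = e * of_real (1 / sqrt (2 * pi)) *
      (LINT v|lborel. complex_of_real (exp (- (e\<^sup>2 * v\<^sup>2) / 2)) * cis (v * x))"
    unfolding eq val by (simp add: scaleR_conv_of_real)
  then show ?I
    using assms by (simp add: field_simps power_divide flip: of_real_mult)
qed

lemma cis_sum: "finite I \<Longrightarrow> cis (\<Sum>i\<in>I. f i) = (\<Prod>i\<in>I. cis (f i))"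
  by (simp add: cis_conv_exp exp_sum sum_distrib_left)

text \<open>The Gaussian and the character both factor over the coordinates, which reduces the claim
  to dimension one.\<close>

lemma gaussian_fourier:
  fixes x :: "'a::euclidean_space"
  assumes "e > 0"
  shows "integrable lborel (\<lambda>v. complex_of_real (exp (- (e\<^sup>2 * (norm v)\<^sup>2) / 2)) * cis (v \<bullet> x))" (is ?i)
    and "(LINT v|lborel. complex_of_real (exp (- (e\<^sup>2 * (norm v)\<^sup>2) / 2)) * cis (v \<bullet> x)) =
      complex_of_real ((sqrt (2 * pi) / e) ^ DIM('a) * exp (- ((norm x)\<^sup>2) / (2 * e\<^sup>2)))" (is ?I)
proof -
  have nrm: "(norm v)\<^sup>2 = (\<Sum>i\<in>Basis. (v \<bullet> i)\<^sup>2)" for v :: 'a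
    by (metis (no_types, lifting) euclidean_inner power2_eq_square power2_norm_eq_inner sum.cong)
  have eq: "complex_of_real (exp (- (e\<^sup>2 * (norm v)\<^sup>2) / 2)) * cis (v \<bullet> x) =
     (\<Prod>i\<in>Basis. complex_of_real (exp (- (e\<^sup>2 * (v \<bullet> i)\<^sup>2) / 2)) * cis ((v \<bullet> i) * (x \<bullet> i)))" for v
  proof -
    have "- (e\<^sup>2 * (norm v)\<^sup>2) / 2 = (\<Sum>i\<in>Basis. - (e\<^sup>2 * (v \<bullet> i)\<^sup>2) / 2)"
      unfolding nrm by (simp add: sum_distrib_left sum_negf sum_divide_distrib)
    then show ?thesis
      by (simp add: prod.distrib exp_sum euclidean_inner[of v x] cis_sum)
  qed
  show ?i
    unfolding eq by (rule integrable_lborel_prod) (rule gaussian_fourier_real(1)[OF assms])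
  have eq2: "- (norm x)\<^sup>2 / (2 * e\<^sup>2) = (\<Sum>i\<in>Basis. - ((x \<bullet> i)\<^sup>2) / (2 * e\<^sup>2))"
    unfolding nrm by (simp add: sum_negf sum_divide_distrib)
  show ?I
    unfolding eq eq2 using gaussian_fourier_real[OF assms]
    by (subst integral_lborel_prod) (simp_all add: prod.distrib exp_sum prod_dividef power_divide)
qed

text \<open>The density of the centred normal distribution with covariance e^2 times the identity,
  that is, the heat kernel at time e^2/2. The parameter \<open>e\<close> is a length.\<close>

definition heat_kernel :: "real \<Rightarrow> 'a::euclidean_space \<Rightarrow> real" where
  "heat_kernel e x = (1 / (sqrt (2 * pi) * e)) ^ DIM('a) * exp (- (norm x)\<^sup>2 / (2 * e\<^sup>2))"

lemma heat_kernel_nonneg: "e > 0 \<Longrightarrow> heat_kernel e x \<ge> 0"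
  by (simp add: heat_kernel_def)

lemma measurable_heat_kernel [measurable]: "heat_kernel e \<in> borel_measurable borel"
  unfolding heat_kernel_def by measurable

text \<open>This is how \<open>Ap_repr\<close> gets exploited: its identity pairs \<open>F\<close>
  with the transform of a Schwartz function, and a Gaussian modulated by
  \<open>cis (v \<bullet> t)\<close> makes that transform a heat kernel centred at \<open>t\<close>.
  The factor (2 pi)^(-m) in \<open>fourier\<close> normalizes it to mass 1.\<close>

lemma fourier_gaussian:
  fixes t :: "'a::euclidean_space"
  assumes "e > 0"
  shows "fourier (\<lambda>v. complex_of_real (exp (- (e\<^sup>2 * (norm v)\<^sup>2) / 2)) * cis (v \<bullet> t)) s =
    complex_of_real (heat_kernel e (s - t))"
proof -
  have eq: "complex_of_real (exp (- (e\<^sup>2 * (norm v)\<^sup>2) / 2)) * cis (v \<bullet> t) * cis (- (s \<bullet> v)) =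
    complex_of_real (exp (- (e\<^sup>2 * (norm v)\<^sup>2) / 2)) * cis (v \<bullet> (t - s))" for v
    by (simp add: mult.assoc cis_mult inner_diff_right inner_commute)
  have sq: "(2 * pi) powr - real DIM('a) * (sqrt (2 * pi) / e) ^ DIM('a) = (1 / (sqrt (2 * pi) * e)) ^ DIM('a)"
  proof -
    have "(2 * pi) powr - real DIM('a) = (1 / (sqrt (2 * pi) * sqrt (2 * pi))) ^ DIM('a)"
      by (simp add: powr_minus powr_realpow power_divide inverse_eq_divide)
    moreover have "(1 / (sqrt (2 * pi) * sqrt (2 * pi))) * (sqrt (2 * pi) / e) = 1 / (sqrt (2 * pi) * e)"
      by (simp del: real_sqrt_mult_self real_sqrt_mult)
    ultimately show ?thesis
      by (metis power_mult_distrib)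
  qed
  show ?thesis
    unfolding fourier_def eq gaussian_fourier(2)[OF assms] heat_kernel_def
    by (simp add: norm_minus_commute mult.assoc[symmetric] flip: sq of_real_mult)
qed

text \<open>The kernel is a multiple of the Gaussian with parameter 1/e, so its mass is read off
  from the Fourier integral of that Gaussian at frequency 0.\<close>

lemma
  fixes t :: "'a::euclidean_space"
  assumes "e > 0"
  shows integrable_heat_kernel: "integrable lborel (\<lambda>s. heat_kernel e (s - t))"
    and integral_heat_kernel: "(LINT s|lborel. heat_kernel e (s - t)) = 1"
proof -
  have e: "1 / e > 0" using assms by simp
  let ?G = "\<lambda>v::'a. exp (- ((1 / e)\<^sup>2 * (norm v)\<^sup>2) / 2)"
  have hk: "heat_kernel e v = (1 / (sqrt (2 * pi) * e)) ^ DIM('a) * ?G v" for v :: 'a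
    by (simp add: heat_kernel_def power_divide field_simps)
  have i: "integrable lborel (\<lambda>v. complex_of_real (?G v))"
    and I: "(LINT v|lborel. complex_of_real (?G v)) = of_real ((sqrt (2 * pi) / (1 / e)) ^ DIM('a))"
    using gaussian_fourier[OF e, of "0::'a"] by simp_all
  have i': "integrable lborel ?G"
    using i by (subst (asm) complex_of_real_integrable_eq)
  have I': "(LINT v|lborel. ?G v) = (sqrt (2 * pi) * e) ^ DIM('a)"
    using I by (simp only: integral_complex_of_real of_real_eq_iff) simp
  have hi: "integrable lborel (heat_kernel e :: 'a \<Rightarrow> real)"
    using i' unfolding hk[abs_def] by simp
  show "integrable lborel (\<lambda>s. heat_kernel e (s - t))"
    using integrable_lborel_affine[OF hi, of 1 "-t"] by simp
  have "(LINT s|lborel. heat_kernel e (s - t)) = (LINT s|lborel. heat_kernel e (s :: 'a))"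
    using integral_lborel_affine[of "heat_kernel e :: 'a \<Rightarrow> real" 1 "-t"] by simp
  also have "\<dots> = 1"
    unfolding hk using I' assms by (simp add: power_divide)
  finally show "(LINT s|lborel. heat_kernel e (s - t)) = 1" .
qed

section \<open>Modulated Gaussians are Schwartz functions\<close>

text \<open>The complex polynomials in the coordinates, generated inductively so that closure under
  derivatives and polynomial growth are plain inductions. Degrees are not tracked, since Gaussian
  decay beats every power.\<close>

inductive_set poly_functions :: "('a::euclidean_space \<Rightarrow> complex) set" where
  const: "(\<lambda>_. c) \<in> poly_functions"
| coord: "(\<lambda>x. complex_of_real (x \<bullet> y)) \<in> poly_functions"
| add: "p \<in> poly_functions \<Longrightarrow> q \<in> poly_functions \<Longrightarrow> (\<lambda>x. p x + q x) \<in> poly_functions"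
| mult: "p \<in> poly_functions \<Longrightarrow> q \<in> poly_functions \<Longrightarrow> (\<lambda>x. p x * q x) \<in> poly_functions"

lemma poly_functions_derivative:
  assumes "p \<in> poly_functions"
  shows "\<exists>D. (\<forall>x. (p has_derivative D x) (at x)) \<and> (\<forall>y. (\<lambda>x. D x y) \<in> poly_functions)"
  using assms
proof induction
  case (const c)
  then show ?case
    by (intro exI[of _ "\<lambda>_ _. 0"]) (auto intro: poly_functions.const)
next
  case (coord y)
  then show ?case
    by (intro exI[of _ "\<lambda>_ h. complex_of_real (h \<bullet> y)"])
      (auto intro: poly_functions.const intro!: derivative_eq_intros)
next
  case (add p q)
  then obtain D E where
    "\<forall>x. (p has_derivative D x) (at x)" "\<forall>y. (\<lambda>x. D x y) \<in> poly_functions"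
    "\<forall>x. (q has_derivative E x) (at x)" "\<forall>y. (\<lambda>x. E x y) \<in> poly_functions" by auto
  then show ?case
    by (intro exI[of _ "\<lambda>x h. D x h + E x h"]) (auto intro: poly_functions.add has_derivative_add)
next
  case (mult p q)
  then obtain D E where
    "\<forall>x. (p has_derivative D x) (at x)" "\<forall>y. (\<lambda>x. D x y) \<in> poly_functions"
    "\<forall>x. (q has_derivative E x) (at x)" "\<forall>y. (\<lambda>x. E x y) \<in> poly_functions" by auto
  with mult show ?case
    by (intro exI[of _ "\<lambda>x h. p x * E x h + D x h * q x"])
      (auto intro!: poly_functions.add poly_functions.mult has_derivative_mult)
qed

lemma poly_functions_bound:
  assumes "p \<in> poly_functions"
  shows "\<exists>C N. \<forall>x. norm (p x) \<le> C * (1 + norm x) ^ N"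
  using assms
proof induction
  case (const c)
  show ?case by (intro exI[of _ "norm c"] exI[of _ 0]) simp
next
  case (coord y)
  have "\<bar>x \<bullet> y\<bar> \<le> norm y * (1 + norm x)" for x
    using Cauchy_Schwarz_ineq2[of x y] by (simp add: algebra_simps add_increasing)
  then show ?case by (intro exI[of _ "norm y"] exI[of _ 1]) simp
next
  case (add p q)
  then obtain C N D M where C: "\<And>x. norm (p x) \<le> C * (1 + norm x) ^ N"
    and D: "\<And>x. norm (q x) \<le> D * (1 + norm x) ^ M" by auto
  have C0: "C \<ge> 0" and D0: "D \<ge> 0"
    using C[of 0] D[of 0] by (simp_all add: order_trans[OF norm_ge_zero])
  have "norm (p x + q x) \<le> (C + D) * (1 + norm x) ^ max N M" for x
  proof -
    have "(1 + norm x) ^ N \<le> (1 + norm x) ^ max N M" "(1 + norm x) ^ M \<le> (1 + norm x) ^ max N M"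
      by (intro power_increasing; simp)+
    then have "C * (1 + norm x) ^ N \<le> C * (1 + norm x) ^ max N M" "D * (1 + norm x) ^ M \<le> D * (1 + norm x) ^ max N M"
      using C0 D0 by (simp_all add: mult_left_mono)
    then show ?thesis
      using norm_triangle_ineq[of "p x" "q x"] C[of x] D[of x] by (simp add: distrib_right)
  qed
  then show ?case by blast
next
  case (mult p q)
  then obtain C N D M where C: "\<And>x. norm (p x) \<le> C * (1 + norm x) ^ N"
    and D: "\<And>x. norm (q x) \<le> D * (1 + norm x) ^ M" by auto
  have C0: "C \<ge> 0"
    using C[of 0] by (simp add: order_trans[OF norm_ge_zero])
  have "norm (p x * q x) \<le> (C * D) * (1 + norm x) ^ (N + M)" for x
    using mult_mono[OF C[of x] D[of x]] C0 by (simp add: norm_mult power_add mult_ac)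
  then show ?case by blast
qed

lemma gaussian_decay:
  fixes a :: real
  assumes "a > 0"
  shows "\<exists>B. \<forall>r\<ge>0. (1 + r) ^ n * exp (- (a * r\<^sup>2)) \<le> B"
proof -
  let ?f = "\<lambda>r::real. (1 + r) ^ n * exp (- (a * r\<^sup>2))"
  have "(?f \<longlongrightarrow> 0) at_top"
    using assms by real_asymp
  then have "eventually (\<lambda>r. ?f r < 1) at_top"
    by (rule order_tendstoD) simp
  then obtain R where R: "\<And>r. r \<ge> R \<Longrightarrow> ?f r < 1"
    by (auto simp: eventually_at_top_linorder)
  have "compact (?f ` {0..R})"
    by (intro compact_continuous_image continuous_intros) auto
  then obtain B where B: "\<And>r. r \<in> {0..R} \<Longrightarrow> norm (?f r) \<le> B"
    by (meson bounded_iff compact_imp_bounded image_eqI)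
  have "?f r \<le> max B 1" if "r \<ge> 0" for r
    using R[of r] B[of r] that by (cases "r \<le> R") auto
  then show ?thesis by blast
qed

text \<open>Differentiating \<open>G\<close> reproduces \<open>G\<close> with an affine factor. By
  induction on the list of directions every iterated derivative is therefore a polynomial function
  times the same \<open>G\<close>, and \<open>gaussian_decay\<close> bounds it against any
  weight.\<close>

lemma gaussian_schwartz:
  fixes t :: "'a::euclidean_space"
  assumes "a > 0"
  shows "(\<lambda>v. complex_of_real (exp (- (a * (norm v)\<^sup>2))) * cis (v \<bullet> t)) \<in> schwartz"
proof -
  define G where "G v = complex_of_real (exp (- (a * (norm v)\<^sup>2))) * cis (v \<bullet> t)" for v
  \<comment> \<open>Written as a single complex exponential, so that one chain rule yields the
    derivative.\<close>
  have Gexp: "G = (\<lambda>v. exp (complex_of_real (- (a * (v \<bullet> v))) + \<i> * complex_of_real (v \<bullet> t)))"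
    by (auto simp: G_def cis_conv_exp exp_add exp_of_real dot_square_norm simp flip: of_real_power of_real_mult of_real_minus)
  have dG: "(G has_derivative (\<lambda>h. (complex_of_real (- 2 * a) * complex_of_real (x \<bullet> h) +
      \<i> * complex_of_real (h \<bullet> t)) * G x)) (at x)" for x
    unfolding Gexp
    by (rule has_derivative_eq_rhs, rule has_derivative_compose[OF _ DERIV_exp[unfolded has_field_derivative_def]])
       (auto intro!: derivative_eq_intros simp: fun_eq_iff inner_commute algebra_simps)
  have step: "\<exists>D. (\<forall>x. ((\<lambda>x. p x * G x) has_derivative D x) (at x)) \<and>
      (\<forall>y. \<exists>q\<in>poly_functions. \<forall>x. D x y = q x * G x)" if p: "p \<in> poly_functions" for p
  proof -
    obtain D where D: "\<forall>x. (p has_derivative D x) (at x)" "\<forall>y. (\<lambda>x. D x y) \<in> poly_functions"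
      using poly_functions_derivative[OF p] by auto
    let ?d = "\<lambda>x y. complex_of_real (- 2 * a) * complex_of_real (x \<bullet> y) + \<i> * complex_of_real (y \<bullet> t)"
    have "((\<lambda>x. p x * G x) has_derivative (\<lambda>h. p x * (?d x h * G x) + D x h * G x)) (at x)" for x
      using D(1) dG by (auto intro: has_derivative_mult)
    moreover have "(\<lambda>x. p x * ?d x y + D x y) \<in> poly_functions" for y
      by (intro poly_functions.intros p D(2)[rule_format])
    ultimately show ?thesis
      by (intro exI[of _ "\<lambda>x h. p x * (?d x h * G x) + D x h * G x"])
        (auto simp: distrib_right mult.assoc intro!: bexI[of _ "\<lambda>x. p x * ?d x y + D x y" for y])
  qed
  have pd: "\<exists>p\<in>poly_functions. pderivs is G = (\<lambda>x. p x * G x)" for "is"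
  proof (induction "is")
    case Nil
    show ?case by (intro bexI[of _ "\<lambda>_. 1"]) (auto intro: poly_functions.const)
  next
    case (Cons i "is")
    then obtain p where p: "p \<in> poly_functions" "pderivs is G = (\<lambda>x. p x * G x)" by auto
    obtain D where D: "\<forall>x. ((\<lambda>x. p x * G x) has_derivative D x) (at x)"
      "\<forall>y. \<exists>q\<in>poly_functions. \<forall>x. D x y = q x * G x"
      using step[OF p(1)] by auto
    have "frechet_derivative (\<lambda>x. p x * G x) (at x) = D x" for x
      using D(1) frechet_derivative_at by metis
    then have "pderivs (i # is) G = (\<lambda>x. D x i)"
      unfolding pderivs.simps p(2) by simp
    with D(2) show ?case by (metis (no_types, lifting) ext)
  qed
  have "(\<forall>x. pderivs is G differentiable (at x)) \<and>
    (\<forall>N::nat. bounded (range (\<lambda>x. ((1 + norm x) ^ N) *\<^sub>R pderivs is G x)))" for "is"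
  proof -
    obtain p where p: "p \<in> poly_functions" "pderivs is G = (\<lambda>x. p x * G x)" using pd by blast
    have "\<forall>x. pderivs is G differentiable (at x)"
      using step[OF p(1)] unfolding p(2) differentiable_def by blast
    moreover have "bounded (range (\<lambda>x. ((1 + norm x) ^ N) *\<^sub>R pderivs is G x))" for N
    proof -
      obtain C M where C: "\<And>x. norm (p x) \<le> C * (1 + norm x) ^ M"
        using poly_functions_bound[OF p(1)] by auto
      have C0: "C \<ge> 0"
        using C[of 0] by (simp add: order_trans[OF norm_ge_zero])
      obtain B where B: "\<And>r. r \<ge> 0 \<Longrightarrow> (1 + r) ^ (M + N) * exp (- (a * r\<^sup>2)) \<le> B"
        using gaussian_decay[OF assms] by blast
      have "norm (((1 + norm x) ^ N) *\<^sub>R pderivs is G x) \<le> C * B" for x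
      proof -
        have "norm (((1 + norm x) ^ N) *\<^sub>R pderivs is G x)
            = (1 + norm x) ^ N * (norm (p x) * exp (- (a * (norm x)\<^sup>2)))"
          by (simp add: p(2) G_def norm_mult)
        also have "\<dots> \<le> (1 + norm x) ^ N * (C * (1 + norm x) ^ M * exp (- (a * (norm x)\<^sup>2)))"
          using C by (intro mult_left_mono mult_right_mono) auto
        also have "\<dots> = C * ((1 + norm x) ^ (M + N) * exp (- (a * (norm x)\<^sup>2)))"
          by (simp add: power_add mult_ac)
        also have "\<dots> \<le> C * B"
          using B[of "norm x"] C0 by (intro mult_left_mono) auto
        finally show ?thesis .
      qed
      then show ?thesis unfolding bounded_iff by blast
    qed
    ultimately show ?thesis by blast
  qed
  then show ?thesis
    unfolding schwartz_def G_def[symmetric] by blast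
qed

section \<open>Mollification by the heat kernel and pairing with non-smooth functions\<close>

lemma Ap_repr_gaussian_integrable:
  assumes "Ap_repr p F g" "b > 0"
  shows "integrable lborel (\<lambda>s. F s * complex_of_real (exp (- (b * (norm s)\<^sup>2))))"
  using assms gaussian_schwartz[OF \<open>b > 0\<close>, of 0] by (auto simp: Ap_repr_def)

text \<open>The two sides differ by half of the square of the norm of
  \<open>s - 2 *\<^sub>R t\<close>. This recentres a Gaussian from \<open>t\<close> to the origin at
  the price of halving the exponent in \<open>s\<close>.\<close>

lemma norm_diff_square_ge: "(norm (s - t))\<^sup>2 \<ge> (norm s)\<^sup>2 / 2 - (norm t)\<^sup>2"
  for s t :: "'a::real_inner"
proof -
  have "0 \<le> (norm (s - 2 *\<^sub>R t))\<^sup>2" by simp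
  then show ?thesis
    by (simp add: power2_norm_eq_inner inner_diff_left inner_diff_right inner_commute algebra_simps)
qed

text \<open>The mollified \<open>F\<close> is a Fourier integral of \<open>g\<close> with Gaussian
  damping. Integrability holds because a heat kernel centred at \<open>t\<close> is dominated by a
  wider Gaussian centred at 0, against which \<open>F\<close> is integrable.\<close>

lemma Ap_repr_heat:
  fixes t :: "'a::euclidean_space"
  assumes Ap: "Ap_repr p F g" and e: "e > 0"
  shows "integrable lborel (\<lambda>s. F s * complex_of_real (heat_kernel e (s - t)))" (is ?i)
    and "(LINT s|lborel. F s * complex_of_real (heat_kernel e (s - t))) =
      (LINT v|lborel. g v * (complex_of_real (exp (- (e\<^sup>2 * (norm v)\<^sup>2) / 2)) * cis (v \<bullet> t)))" (is ?I)
proof -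
  have [measurable]: "F \<in> borel_measurable borel"
    using Ap by (auto simp: Ap_repr_def)
  have "(\<lambda>v. complex_of_real (exp (- (e\<^sup>2 * (norm v)\<^sup>2) / 2)) * cis (v \<bullet> t)) \<in> schwartz"
    using gaussian_schwartz[of "e\<^sup>2 / 2" t] e by simp
  with Ap show ?I
    unfolding Ap_repr_def fourier_gaussian[OF e, symmetric] by blast
  define C where "C = (1 / (sqrt (2 * pi) * e)) ^ DIM('a) * exp ((norm t)\<^sup>2 / (2 * e\<^sup>2))"
  have bound: "heat_kernel e (s - t) \<le> C * exp (- (1 / (4 * e\<^sup>2) * (norm s)\<^sup>2))" for s
  proof -
    have "- (norm (s - t))\<^sup>2 / (2 * e\<^sup>2) \<le> (norm t)\<^sup>2 / (2 * e\<^sup>2) + - (1 / (4 * e\<^sup>2) * (norm s)\<^sup>2)"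
      using norm_diff_square_ge[of s t] e by (simp add: field_simps)
    then have "exp (- (norm (s - t))\<^sup>2 / (2 * e\<^sup>2)) \<le>
        exp ((norm t)\<^sup>2 / (2 * e\<^sup>2)) * exp (- (1 / (4 * e\<^sup>2) * (norm s)\<^sup>2))"
      by (simp flip: exp_add)
    then show ?thesis
      using e unfolding heat_kernel_def C_def by (simp add: mult_left_mono mult.assoc)
  qed
  have "integrable lborel (\<lambda>s. complex_of_real C * (F s * complex_of_real (exp (- (1 / (4 * e\<^sup>2) * (norm s)\<^sup>2)))))"
    using e by (intro integrable_mult_right Ap_repr_gaussian_integrable[OF Ap]) simp
  then show ?i
  proof (rule Bochner_Integration.integrable_bound)
    have "norm (F s) * heat_kernel e (s - t) \<le> norm (F s) * (C * exp (- (1 / (4 * e\<^sup>2) * (norm s)\<^sup>2)))" for s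
      by (intro mult_left_mono bound) auto
    moreover have "C \<ge> 0" using e by (simp add: C_def)
    ultimately show "AE s in lborel. norm (F s * complex_of_real (heat_kernel e (s - t))) \<le>
        norm (complex_of_real C * (F s * complex_of_real (exp (- (1 / (4 * e\<^sup>2) * (norm s)\<^sup>2)))))"
      using e by (simp add: norm_mult heat_kernel_nonneg mult_ac)
  qed measurable
qed

text \<open>The exponent is split into two halves. One yields exp(-d^2/(4 e^2)), which overcomes the
  prefactor as e tends to 0. The other is at least the square of \<open>norm (s - t)\<close>, since
  4 e^2 \<le> 1, and leaves a Gaussian in \<open>s\<close> that does not depend on
  \<open>e\<close>.\<close>

lemma heat_kernel_far:
  fixes s t :: "'a::euclidean_space"
  assumes e: "0 < e" "e \<le> 1 / 2" and d: "0 \<le> d" "d \<le> dist s t"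
  shows "heat_kernel e (s - t) \<le>
    (1 / (sqrt (2 * pi) * e)) ^ DIM('a) * exp (- d\<^sup>2 / (4 * e\<^sup>2)) * (exp ((norm t)\<^sup>2) * exp (- (1 / 2 * (norm s)\<^sup>2)))"
proof -
  define X where "X = (norm (s - t))\<^sup>2"
  have d2: "d\<^sup>2 \<le> X"
    unfolding X_def using d by (intro power_mono) (auto simp: dist_norm)
  have e2: "4 * e\<^sup>2 \<le> 1"
    using power_mono[OF e(2), of 2] e(1) by (simp add: power_divide)
  have "X * (4 * e\<^sup>2) \<le> X * 1"
    by (intro mult_left_mono e2) (simp add: X_def)
  then have "X \<le> X / (4 * e\<^sup>2)"
    using e by (simp add: pos_le_divide_eq)
  moreover have "d\<^sup>2 / (4 * e\<^sup>2) \<le> X / (4 * e\<^sup>2)"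
    using d2 by (intro divide_right_mono) auto
  moreover have "X / (2 * e\<^sup>2) = X / (4 * e\<^sup>2) + X / (4 * e\<^sup>2)"
    by (simp add: field_simps)
  moreover have "(norm s)\<^sup>2 / 2 - (norm t)\<^sup>2 \<le> X"
    unfolding X_def by (rule norm_diff_square_ge)
  ultimately have "- X / (2 * e\<^sup>2) \<le> - d\<^sup>2 / (4 * e\<^sup>2) + ((norm t)\<^sup>2 + - (1 / 2 * (norm s)\<^sup>2))"
    by simp
  then have "exp (- X / (2 * e\<^sup>2)) \<le> exp (- d\<^sup>2 / (4 * e\<^sup>2)) * (exp ((norm t)\<^sup>2) * exp (- (1 / 2 * (norm s)\<^sup>2)))"
    by (simp flip: exp_add)
  then show ?thesis
    using e unfolding heat_kernel_def X_def by (simp add: mult_left_mono mult.assoc)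
qed

text \<open>The approximate identity argument, uniform over \<open>B\<close>. Since \<open>F\<close>
  may grow, the far part keeps a fixed Gaussian weight from \<open>heat_kernel_far\<close>; what
  remains is the factor \<open>\<kappa> e\<close>, which tends to 0.\<close>

lemma heat_approx:
  fixes F :: "'a::euclidean_space \<Rightarrow> complex"
  assumes Ap: "Ap_repr p F g"
    and R: "\<And>t. t \<in> B \<Longrightarrow> norm t \<le> R" and M: "\<And>t. t \<in> B \<Longrightarrow> norm (F t) \<le> M"
    and "d > 0" "\<eta> > 0"
    and near: "\<And>s t. t \<in> B \<Longrightarrow> dist s t < d \<Longrightarrow> norm (F s - F t) \<le> \<eta>"
  shows "\<forall>\<^sub>F e in at_right 0. \<forall>t\<in>B.
    norm ((LINT s|lborel. F s * complex_of_real (heat_kernel e (s - t))) - F t) \<le> 2 * \<eta>"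
proof -
  let ?G = "\<lambda>s::'a. exp (- (1 / 2 * (norm s)\<^sup>2))"
  define \<kappa> where "\<kappa> e = (1 / (sqrt (2 * pi) * e)) ^ DIM('a) * exp (- d\<^sup>2 / (4 * e\<^sup>2))" for e
  have FG: "integrable lborel (\<lambda>s. norm (F s) * ?G s)"
    using integrable_norm[OF Ap_repr_gaussian_integrable[OF Ap, of "1/2"]] by (simp add: norm_mult)
  have "integrable lborel (\<lambda>s. complex_of_real (exp (- (1\<^sup>2 * (norm s)\<^sup>2) / 2)) * cis (s \<bullet> (0::'a)))"
    by (rule gaussian_fourier) simp
  from integrable_norm[OF this] have G: "integrable lborel ?G"
    by simp
  \<comment> \<open>Far from \<open>t\<close> the difference is at most
    \<open>norm (F s) + \<bar>M\<bar>\<close>, and this constant is independent of \<open>e\<close>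
    and \<open>t\<close>. The absolute value is there because an empty \<open>B\<close> gives no
    sign for \<open>M\<close>.\<close>
  define K where "K = (LINT s|lborel. (norm (F s) + \<bar>M\<bar>) * ?G s)"
  have Kint: "integrable lborel (\<lambda>s. (norm (F s) + \<bar>M\<bar>) * ?G s)"
    using FG G by (simp add: distrib_right)
  have "((\<lambda>e. \<kappa> e * (exp (R\<^sup>2) * K)) \<longlongrightarrow> 0 * (exp (R\<^sup>2) * K)) (at_right 0)"
    unfolding \<kappa>_def using \<open>d > 0\<close> by (intro tendsto_mult_right) real_asymp
  then have "\<forall>\<^sub>F e in at_right 0. \<kappa> e * (exp (R\<^sup>2) * K) < \<eta>"
    using \<open>\<eta> > 0\<close> by (intro order_tendstoD(2)[where y=0]) auto
  moreover have "\<forall>\<^sub>F e::real in at_right 0. e \<in> {0<..<1/2}"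
    by (rule eventually_at_right_real) simp
  ultimately show ?thesis
  proof eventually_elim
    case (elim e)
    show ?case
    proof
      fix t assume t: "t \<in> B"
      let ?h = "\<lambda>s. heat_kernel e (s - t)"
      have e: "e > 0" "e \<le> 1 / 2" using elim by auto
      have \<kappa>0: "\<kappa> e \<ge> 0" using e by (simp add: \<kappa>_def)
      have i1: "integrable lborel (\<lambda>s. F s * complex_of_real (?h s))"
        by (rule Ap_repr_heat(1)[OF Ap e(1)])
      have i2: "integrable lborel (\<lambda>s. F t * complex_of_real (?h s))"
        using integrable_heat_kernel[OF e(1), of t] by simp
      have "(LINT s|lborel. F t * complex_of_real (?h s)) = F t"
        using integral_heat_kernel[OF e(1), of t] by simp
      then have eq: "(LINT s|lborel. F s * complex_of_real (?h s)) - F t =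
          (LINT s|lborel. (F s - F t) * complex_of_real (?h s))"
        using Bochner_Integration.integral_diff[OF i1 i2] by (simp add: left_diff_distrib)
      \<comment> \<open>The sum of the near and the far bound: both are nonnegative, so one
        integrable majorant serves every \<open>s\<close>.\<close>
      let ?b = "\<lambda>s. \<eta> * ?h s + \<kappa> e * (exp (R\<^sup>2) * ((norm (F s) + \<bar>M\<bar>) * ?G s))"
      have ib: "integrable lborel ?b"
        using integrable_heat_kernel[OF e(1), of t] Kint by auto
      have "norm ((F s - F t) * complex_of_real (?h s)) \<le> ?b s" for s
      proof (cases "dist s t < d")
        case True
        have "norm (F s - F t) * ?h s \<le> \<eta> * ?h s"
          using near[OF t True] heat_kernel_nonneg[OF e(1)] by (rule mult_right_mono)
        moreover have "0 \<le> \<kappa> e * (exp (R\<^sup>2) * ((norm (F s) + \<bar>M\<bar>) * ?G s))"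
          using \<kappa>0 by simp
        ultimately show ?thesis
          using heat_kernel_nonneg[OF e(1), of "s - t"] by (simp add: norm_mult)
      next
        case False
        have "exp ((norm t)\<^sup>2) \<le> exp (R\<^sup>2)"
          using R[OF t] by (simp add: power_mono)
        then have "\<kappa> e * (exp ((norm t)\<^sup>2) * ?G s) \<le> \<kappa> e * (exp (R\<^sup>2) * ?G s)"
          using \<kappa>0 by (intro mult_left_mono mult_right_mono) auto
        then have h: "?h s \<le> \<kappa> e * (exp (R\<^sup>2) * ?G s)"
          using heat_kernel_far[OF e, of d s t] False \<open>d > 0\<close> unfolding \<kappa>_def by linarith
        have "norm (F s - F t) \<le> norm (F s) + \<bar>M\<bar>"
          using norm_triangle_ineq4[of "F s" "F t"] M[OF t] by linarith
        then have "norm (F s - F t) * ?h s \<le> (norm (F s) + \<bar>M\<bar>) * (\<kappa> e * (exp (R\<^sup>2) * ?G s))"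
          using h heat_kernel_nonneg[OF e(1), of "s - t"] by (intro mult_mono) auto
        moreover have "0 \<le> \<eta> * ?h s"
          using \<open>\<eta> > 0\<close> heat_kernel_nonneg[OF e(1), of "s - t"] by simp
        ultimately show ?thesis
          using heat_kernel_nonneg[OF e(1), of "s - t"] by (simp add: norm_mult mult_ac)
      qed
      moreover have "integrable lborel (\<lambda>s. (F s - F t) * complex_of_real (?h s))"
        using Bochner_Integration.integrable_diff[OF i1 i2] by (simp add: left_diff_distrib)
      ultimately have "norm ((LINT s|lborel. F s * complex_of_real (?h s)) - F t) \<le> (LINT s|lborel. ?b s)"
        unfolding eq using Bochner_Integration.integral_norm_bound_integral[OF _ ib] by blast
      also have "\<dots> = \<eta> + \<kappa> e * (exp (R\<^sup>2) * K)"
        using integrable_heat_kernel[OF e(1), of t] integral_heat_kernel[OF e(1), of t] Kint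
        unfolding K_def by (subst Bochner_Integration.integral_add) auto
      finally show "norm ((LINT s|lborel. F s * complex_of_real (?h s)) - F t) \<le> 2 * \<eta>"
        using elim by simp
    qed
  qed
qed

text \<open>Mollifying \<open>F\<close> by the heat kernel makes its Fourier transform integrable, so that \<open>k\<close> need
  not be a Schwartz function: Fubini applies to the mollified function, and continuity of \<open>F\<close> near
  the support of \<open>k\<close> allows the limit.\<close>

lemma pairing_bound:
  fixes F g k :: "'a::euclidean_space \<Rightarrow> complex"
  assumes Ap: "Ap_repr p F g" and p: "1 \<le> p"
    and V: "open V" "continuous_on V F" and B: "compact B" "B \<subseteq> V"
    and [measurable]: "k \<in> borel_measurable borel" and k1: "\<And>t. norm (k t) \<le> 1"
    and k0: "\<And>t. t \<notin> B \<Longrightarrow> k t = 0"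
  shows "ennreal (norm (LINT t|lborel. F t * k t)) \<le>
    (\<integral>\<^sup>+v. ennreal (norm (g v) * norm (LINT t|lborel. k t * cis (v \<bullet> t))) \<partial>lborel)"
proof (rule ennreal_le_epsilon)
  fix \<epsilon> :: real assume "\<epsilon> > 0"
  have [measurable]: "F \<in> borel_measurable borel" "g \<in> borel_measurable borel"
    using Ap by (auto simp: Ap_repr_def)
  have gp: "integrable lborel (\<lambda>u. norm (g u) powr p)"
    using Ap by (auto simp: Ap_repr_def)
  have Bb: "emeasure lborel B < \<infinity>"
    using B(1) emeasure_compact_finite by blast
  have [measurable]: "B \<in> sets borel" using B(1) by (simp add: borel_compact)
  have iB: "integrable lborel (indicator B :: 'a \<Rightarrow> real)"
    using Bb by (simp add: less_top)
  obtain R where R: "\<And>t. t \<in> B \<Longrightarrow> norm t \<le> R"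
    using B(1) compact_imp_bounded bounded_iff by metis
  obtain M where M: "\<And>t. t \<in> B \<Longrightarrow> norm (F t) \<le> M"
    using compact_imp_bounded[OF compact_continuous_image[OF continuous_on_subset[OF V(2) B(2)] B(1)]]
    by (auto simp: bounded_iff)
  \<comment> \<open>Chosen so that the pointwise error \<open>2 * \<eta>\<close>, integrated over
    \<open>B\<close>, is at most \<open>\<epsilon>\<close>; the added 1 covers sets \<open>B\<close>
    of measure 0.\<close>
  define \<eta> where "\<eta> = \<epsilon> / (2 * measure lborel B + 1)"
  have \<eta>: "\<eta> > 0" using \<open>\<epsilon> > 0\<close> by (simp add: \<eta>_def add_nonneg_pos)
  have \<eta>2: "2 * \<eta> * measure lborel B \<le> \<epsilon>"
  proof -
    have pos: "2 * measure lborel B + 1 > 0" by (simp add: add_nonneg_pos)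
    have "2 * \<eta> * measure lborel B \<le> \<eta> * (2 * measure lborel B + 1)"
      using \<eta> by (simp add: algebra_simps)
    also have "\<dots> = \<epsilon>" using pos by (simp add: \<eta>_def)
    finally show ?thesis .
  qed
  \<comment> \<open>Continuity is available only on \<open>V\<close>. Uniform continuity is
    therefore taken on a compact neighbourhood of \<open>B\<close> inside \<open>V\<close>, and
    \<open>d\<close> is capped by \<open>r\<close> to keep \<open>s\<close> in it.\<close>
  obtain d where d: "d > 0" "\<And>s t. t \<in> B \<Longrightarrow> dist s t < d \<Longrightarrow> norm (F s - F t) \<le> \<eta>"
  proof -
    obtain r where r: "r > 0" "(\<Union>x\<in>B. cball x r) \<subseteq> V"
      using compact_subset_open_imp_cball_epsilon_subset[OF B(1) V(1) B(2)] by metis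
    have "uniformly_continuous_on (\<Union>x\<in>B. cball x r) F"
      using continuous_on_subset[OF V(2) r(2)] compact_minkowski_sum_cball[OF B(1)]
      by (rule compact_uniformly_continuous)
    then obtain d where "d > 0" "\<And>s t. s \<in> (\<Union>x\<in>B. cball x r) \<Longrightarrow> t \<in> (\<Union>x\<in>B. cball x r) \<Longrightarrow>
        dist s t < d \<Longrightarrow> dist (F s) (F t) < \<eta>"
      using \<eta> unfolding uniformly_continuous_on_def by metis
    then have "norm (F s - F t) \<le> \<eta>" if "t \<in> B" "dist s t < min d r" for s t
      using that r(1) by (force simp: dist_norm norm_minus_commute less_imp_le)
    then show ?thesis
      using \<open>d > 0\<close> r(1) by (intro that[of "min d r"]) auto
  qed
  have "\<forall>\<^sub>F e in at_right 0. \<forall>t\<in>B.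
    norm ((LINT s|lborel. F s * complex_of_real (heat_kernel e (s - t))) - F t) \<le> 2 * \<eta>"
    by (rule heat_approx[OF Ap R M d(1) \<eta> d(2)])
  from eventually_happens'[OF trivial_limit_at_right_real eventually_conj[OF eventually_at_right_less this]]
  obtain e where e: "e > 0"
    and eB: "\<And>t. t \<in> B \<Longrightarrow>
      norm ((LINT s|lborel. F s * complex_of_real (heat_kernel e (s - t))) - F t) \<le> 2 * \<eta>"
    by blast
  define G where "G v = exp (- (e\<^sup>2 * (norm v)\<^sup>2) / 2)" for v :: 'a
  have [measurable]: "G \<in> borel_measurable borel"
    unfolding G_def by measurable
  have G1: "0 \<le> G v" "G v \<le> 1" for v
    by (simp_all add: G_def)
  have Gi: "integrable lborel G"
    using integrable_norm[OF gaussian_fourier(1)[OF e, of 0]] by (simp add: G_def[abs_def])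
  \<comment> \<open>Where |g| \<le> 1 the Gaussian alone is a majorant; elsewhere |g| \<le> |g|^p
    because p \<ge> 1.\<close>
  have gG: "integrable lborel (\<lambda>v. norm (g v) * G v)"
  proof (rule Bochner_Integration.integrable_bound)
    show "integrable lborel (\<lambda>v. norm (g v) powr p + G v)"
      using gp Gi by simp
    have "norm (g v) * G v \<le> norm (g v) powr p + G v" for v
    proof (cases "norm (g v) \<le> 1")
      case True
      then have "norm (g v) * G v \<le> 1 * G v"
        using G1 by (intro mult_right_mono) auto
      then show ?thesis by (simp add: add_increasing)
    next
      case False
      have "norm (g v) * G v \<le> norm (g v) * 1"
        using G1 by (intro mult_left_mono) auto
      also have "\<dots> \<le> norm (g v) powr p"
        using powr_mono[OF p, of "norm (g v)"] False by simp
      finally show ?thesis using G1(1)[of v] by linarith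
    qed
    then show "AE v in lborel. norm (norm (g v) * G v) \<le> norm (norm (g v) powr p + G v)"
      using G1 by (simp add: abs_of_nonneg)
  qed measurable
  have ik: "integrable lborel (\<lambda>t. norm (k t))"
  proof (rule Bochner_Integration.integrable_bound[OF iB])
    show "AE t in lborel. norm (norm (k t)) \<le> norm (indicator B t :: real)"
      using k1 k0 by (auto split: split_indicator)
  qed measurable
  define S where "S t = (LINT s|lborel. F s * complex_of_real (heat_kernel e (s - t)))" for t
  have S: "S t = (LINT v|lborel. g v * (complex_of_real (G v) * cis (v \<bullet> t)))" for t
    unfolding S_def G_def by (rule Ap_repr_heat(2)[OF Ap e])
  \<comment> \<open>Integrating out \<open>v\<close> gives \<open>S t * k t\<close>; integrating out
    \<open>t\<close> gives the damped \<open>g\<close> times the Fourier integral of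
    \<open>k\<close>. The norm of \<open>f\<close> is a product of two integrable functions of one
    variable each, so Fubini applies.\<close>
  define f where "f t v = k t * (g v * (complex_of_real (G v) * cis (v \<bullet> t)))" for t v
  have nf: "norm (f t v) = norm (k t) * (norm (g v) * G v)" for t v
    using G1 by (simp add: f_def norm_mult)
  have f: "integrable (lborel \<Otimes>\<^sub>M lborel) (case_prod f)"
  proof (rule lborel_pair.Fubini_integrable)
    show "case_prod f \<in> borel_measurable (lborel \<Otimes>\<^sub>M lborel)"
      unfolding f_def by measurable
    show "integrable lborel (\<lambda>x. LINT y|lborel. norm (case (x, y) of (t, v) \<Rightarrow> f t v))"
      using ik by (simp add: nf)
    have "integrable lborel (f t)" for t
    proof (rule Bochner_Integration.integrable_bound)
      show "integrable lborel (\<lambda>v. norm (k t) * (norm (g v) * G v))" using gG by simp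
      show "f t \<in> borel_measurable lborel" unfolding f_def by measurable
    qed (use G1 in \<open>simp add: nf\<close>)
    then show "AE x in lborel. integrable lborel (\<lambda>y. case (x, y) of (t, v) \<Rightarrow> f t v)" by simp
  qed
  have f1: "(LINT v|lborel. f t v) = S t * k t" for t
    unfolding f_def S by (simp add: mult.commute)
  have f2: "(LINT t|lborel. f t v) = g v * complex_of_real (G v) * (LINT t|lborel. k t * cis (v \<bullet> t))" for v
    unfolding f_def by (subst integral_mult_right_zero[symmetric]) (simp add: mult_ac)
  have iSk: "integrable lborel (\<lambda>t. S t * k t)"
    using lborel_pair.integrable_fst[OF f] by (simp add: f1)
  have iFk: "integrable lborel (\<lambda>t. F t * k t)"
  proof (rule Bochner_Integration.integrable_bound)
    show "integrable lborel (\<lambda>t. M * indicator B t)" using iB by simp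
    have "norm (F t) * norm (k t) \<le> M * 1" if "t \<in> B" for t
      using M[OF that] k1[of t] by (intro mult_mono) (auto intro: order_trans[OF norm_ge_zero])
    then show "AE t in lborel. norm (F t * k t) \<le> norm (M * indicator B t)"
      using k0 by (fastforce simp: norm_mult split: split_indicator)
  qed measurable
  have "norm ((LINT t|lborel. F t * k t) - (LINT t|lborel. S t * k t)) =
      norm (LINT t|lborel. F t * k t - S t * k t)"
    using iFk iSk by simp
  also have "\<dots> \<le> (LINT t|lborel. 2 * \<eta> * indicator B t)"
  proof (rule Bochner_Integration.integral_norm_bound_integral)
    show "integrable lborel (\<lambda>t. 2 * \<eta> * indicator B t)" using iB by simp
    show "norm (F t * k t - S t * k t) \<le> 2 * \<eta> * indicator B t" for t
    proof (cases "t \<in> B")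
      case True
      have "norm (F t - S t) * norm (k t) \<le> (2 * \<eta>) * 1"
        using eB[OF True] k1[of t] \<eta> unfolding S_def[symmetric]
        by (intro mult_mono) (auto simp: norm_minus_commute)
      then show ?thesis
        using True by (simp add: norm_mult flip: left_diff_distrib)
    qed (simp add: k0)
  qed (use iFk iSk in simp)
  also have "\<dots> \<le> \<epsilon>" using \<eta>2 by simp
  finally have "norm (LINT t|lborel. F t * k t) \<le> norm (LINT t|lborel. S t * k t) + \<epsilon>"
    using norm_triangle_sub[of "LINT t|lborel. F t * k t" "LINT t|lborel. S t * k t"] by linarith
  then have 1: "ennreal (norm (LINT t|lborel. F t * k t)) \<le> ennreal (norm (LINT t|lborel. S t * k t)) + ennreal \<epsilon>"
    using \<open>\<epsilon> > 0\<close> by (simp flip: ennreal_plus)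
  have "(LINT t|lborel. S t * k t) = (LINT v|lborel. LINT t|lborel. f t v)"
    unfolding lborel_pair.Fubini_integral[OF f] f1 ..
  then have "ennreal (norm (LINT t|lborel. S t * k t)) = ennreal (norm (LINT v|lborel. LINT t|lborel. f t v))"
    by simp
  also have "\<dots> \<le> (\<integral>\<^sup>+v. norm (LINT t|lborel. f t v) \<partial>lborel)"
    by (intro integral_norm_bound_ennreal lborel_pair.integrable_snd f)
  also have "\<dots> \<le> (\<integral>\<^sup>+v. ennreal (norm (g v) * norm (LINT t|lborel. k t * cis (v \<bullet> t))) \<partial>lborel)"
  proof (intro nn_integral_mono ennreal_leI)
    show "norm (LINT t|lborel. f t v) \<le> norm (g v) * norm (LINT t|lborel. k t * cis (v \<bullet> t))" for v
      using G1[of v] unfolding f2 norm_mult by (intro mult_right_mono) (auto intro: mult_left_le)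
  qed
  finally show "ennreal (norm (LINT t|lborel. F t * k t)) \<le>
      (\<integral>\<^sup>+v. ennreal (norm (g v) * norm (LINT t|lborel. k t * cis (v \<bullet> t))) \<partial>lborel) + ennreal \<epsilon>"
    using 1 by (meson add_right_mono order_trans)
qed

section \<open>The bump and the decay of its Fourier integral\<close>

definition bump1 :: "real \<Rightarrow> real" where
  "bump1 x = indicator {-1..1} x * (1 - x\<^sup>2)"

definition bump :: "'a::euclidean_space \<Rightarrow> real" where
  "bump x = (\<Prod>i\<in>Basis. bump1 (x \<bullet> i))"

text \<open>A majorant of the Fourier integral of \<open>bump\<close>, taken without the factor (2
  pi)^(-m). The 1 in the denominator makes it finite at low frequencies while keeping each factor
  integrable on the line.\<close>

definition bump_decay :: "'a::euclidean_space \<Rightarrow> real" where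
  "bump_decay w = (\<Prod>i\<in>Basis. 16 / (1 + (w \<bullet> i)\<^sup>2))"

lemma bump1_bounds: "0 \<le> bump1 x" "bump1 x \<le> 1"
  by (auto simp: bump1_def abs_square_le_1 abs_le_iff split: split_indicator)

lemma measurable_bump1 [measurable]: "bump1 \<in> borel_measurable borel"
  unfolding bump1_def by measurable

lemma measurable_bump [measurable]: "bump \<in> borel_measurable borel"
  unfolding bump_def by measurable

lemma measurable_bump_decay [measurable]: "bump_decay \<in> borel_measurable borel"
  unfolding bump_decay_def by measurable

lemma bump_bounds: "0 \<le> bump x" "bump x \<le> 1"
  by (auto simp: bump_def intro!: prod_nonneg prod_le_1 bump1_bounds)

lemma bump_decay_nonneg: "0 \<le> bump_decay w"
  by (auto simp: bump_decay_def intro!: prod_nonneg divide_nonneg_nonneg)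

text \<open>The support lies in the cube [-1,1]^m, and bounding the Euclidean norm by the l1 norm
  puts it in the ball of radius m. This is the origin of the radius \<open>DIM('a) * r\<close>
  below.\<close>

lemma bump_eq_0:
  fixes x :: "'a::euclidean_space"
  assumes "real DIM('a) < norm x"
  shows "bump x = 0"
proof (rule ccontr)
  assume "bump x \<noteq> 0"
  then have "\<bar>x \<bullet> i\<bar> \<le> 1" if "i \<in> Basis" for i
    using that by (force simp: bump_def bump1_def split: split_indicator_asm)
  then have "(\<Sum>i\<in>Basis. \<bar>x \<bullet> i\<bar>) \<le> (\<Sum>i\<in>(Basis :: 'a set). 1)"
    by (intro sum_mono)
  then show False
    using assms norm_le_l1[of x] by simp
qed

lemma integrable_bump1: "integrable lborel bump1"
  and integral_bump1: "(LINT x|lborel. bump1 x) = 4 / 3"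
proof -
  have d: "((\<lambda>x. x - x ^ 3 / 3) has_real_derivative 1 - x\<^sup>2) (at x)" for x :: real
    by (auto intro!: derivative_eq_intros)
  have c: "isCont (\<lambda>x. 1 - x\<^sup>2) x" for x :: real
    by simp
  from has_bochner_integral_FTC_Icc_real[of "-1" 1 "\<lambda>x. x - x ^ 3 / 3" "\<lambda>x. 1 - x\<^sup>2"] d c
  have "has_bochner_integral lborel bump1 (4 / 3)"
    by (simp add: bump1_def[abs_def] mult.commute)
  then show "integrable lborel bump1" "(LINT x|lborel. bump1 x) = 4 / 3"
    by (auto simp: has_bochner_integral_iff)
qed

text \<open>For small \<open>y\<close> the integral of \<open>bump1\<close>, which is 4/3, is a
  sufficient bound. For |y| > 1 integration by parts gains 1/y^2, since the boundary terms of order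
  1/y vanish; the constant 16 comes from 8/y^2 and 1 + y^2 \<le> 2 y^2.\<close>

lemma bump1_fourier_decay:
  "norm (LINT x|lborel. complex_of_real (bump1 x) * cis (x * y)) \<le> 16 / (1 + y\<^sup>2)"
proof (cases "\<bar>y\<bar> \<le> 1")
  case True
  have "norm (LINT x|lborel. complex_of_real (bump1 x) * cis (x * y)) \<le> (LINT x|lborel. bump1 x)"
  proof (rule integral_norm_bound[THEN order_trans])
  qed (simp add: norm_mult bump1_bounds)
  also have "\<dots> \<le> 16 / 2"
    by (simp add: integral_bump1)
  also have "\<dots> \<le> 16 / (1 + y\<^sup>2)"
    using True by (intro divide_left_mono) (auto simp: abs_square_le_1 add_pos_nonneg)
  finally show ?thesis .
next
  case False
  define c where "c = \<i> * complex_of_real y"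
  have c0: "c \<noteq> 0" and nc: "norm c = \<bar>y\<bar>"
    using False by (auto simp: c_def norm_mult)
  \<comment> \<open>The antiderivative of (1 - z^2) exp(c z) obtained by repeated integration by
    parts. Its first term is zero at both endpoints.\<close>
  define P where "P z = (1 - z\<^sup>2) * exp (c * z) / c + 2 * z * exp (c * z) / c\<^sup>2 - 2 * exp (c * z) / c ^ 3" for z
  have "(P has_field_derivative (1 - z\<^sup>2) * exp (c * z)) (at z)" for z
    unfolding P_def using c0
    by (auto intro!: derivative_eq_intros simp: field_simps power2_eq_square power3_eq_cube)
  then have dP: "((\<lambda>x. P (of_real x)) has_vector_derivative
      (1 - (of_real x)\<^sup>2) * exp (c * of_real x)) (at x within {-1..1})" for x :: real
    by (rule has_vector_derivative_real_field)
  have eq: "complex_of_real (bump1 x) * cis (x * y) =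
      indicator {-1..1} x *\<^sub>R ((1 - (of_real x)\<^sup>2) * exp (c * of_real x))" for x
    by (auto simp: bump1_def cis_conv_exp c_def mult_ac split: split_indicator)
  have "(LINT x|lborel. complex_of_real (bump1 x) * cis (x * y)) = P (of_real 1) - P (of_real (-1))"
    unfolding eq by (rule integral_FTC_Icc[OF _ dP]) (auto intro!: continuous_intros)
  also have "\<dots> = 2 * (exp c + exp (- c)) / c\<^sup>2 - 2 * (exp c - exp (- c)) / c ^ 3"
    by (simp add: P_def add_divide_distrib diff_divide_distrib distrib_left right_diff_distrib mult_ac)
  also have "norm \<dots> \<le> norm (2 * (exp c + exp (- c)) / c\<^sup>2) + norm (2 * (exp c - exp (- c)) / c ^ 3)"
    by (rule norm_triangle_ineq4)
  also have "\<dots> \<le> 4 / y\<^sup>2 + 4 / \<bar>y\<bar> ^ 3"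
  proof -
    have e: "norm (exp c) = 1" "norm (exp (- c)) = 1" by (simp_all add: c_def)
    have "norm (exp c + exp (- c)) \<le> 2" "norm (exp c - exp (- c)) \<le> 2"
      using norm_triangle_ineq[of "exp c" "exp (- c)"] norm_triangle_ineq4[of "exp c" "exp (- c)"] e
      by simp_all
    then have "norm (2 * (exp c + exp (- c))) \<le> 4" "norm (2 * (exp c - exp (- c))) \<le> 4"
      by (simp_all only: norm_mult norm_numeral)
    then show ?thesis
      unfolding norm_divide norm_power nc power2_abs by (intro add_mono divide_right_mono) simp_all
  qed
  also have "\<dots> \<le> 8 / y\<^sup>2"
  proof -
    have "\<bar>y\<bar> ^ 2 \<le> \<bar>y\<bar> ^ 3"
      using False by (intro power_increasing) auto
    then have "4 / \<bar>y\<bar> ^ 3 \<le> 4 / \<bar>y\<bar> ^ 2"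
      using False by (intro divide_left_mono) auto
    then show ?thesis by simp
  qed
  also have "\<dots> \<le> 16 / (1 + y\<^sup>2)"
  proof -
    have "1 \<le> y\<^sup>2" using False one_le_power[of "\<bar>y\<bar>" 2] by simp
    then have "16 / (2 * y\<^sup>2) \<le> 16 / (1 + y\<^sup>2)"
      by (intro divide_left_mono) (auto intro!: mult_pos_pos)
    then show ?thesis by simp
  qed
  finally show ?thesis .
qed

lemma integrable_bump: "integrable lborel (bump :: 'a::euclidean_space \<Rightarrow> real)"
  unfolding bump_def[abs_def] by (rule integrable_lborel_prod) (rule integrable_bump1)

lemma integral_bump: "(LINT x|lborel. bump (x :: 'a::euclidean_space)) = (4 / 3) ^ DIM('a)"
  unfolding bump_def by (subst integral_lborel_prod) (simp_all add: integrable_bump1 integral_bump1)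

lemma bump_fourier_decay:
  fixes w :: "'a::euclidean_space"
  shows "norm (LINT x|lborel. complex_of_real (bump x) * cis (w \<bullet> x)) \<le> bump_decay w"
proof -
  have eq: "complex_of_real (bump x) * cis (w \<bullet> x) =
      (\<Prod>i\<in>Basis. complex_of_real (bump1 (x \<bullet> i)) * cis ((x \<bullet> i) * (w \<bullet> i)))" for x :: 'a
    by (simp add: bump_def prod.distrib euclidean_inner[of w x] cis_sum mult.commute)
  have "integrable lborel (\<lambda>x. complex_of_real (bump1 x) * cis (x * y))" for y
  proof (rule Bochner_Integration.integrable_bound[OF integrable_bump1])
    show "AE x in lborel. norm (complex_of_real (bump1 x) * cis (x * y)) \<le> norm (bump1 x)"
      by (simp add: norm_mult)
  qed measurable
  then show ?thesis
    unfolding eq bump_decay_def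
    by (subst integral_lborel_prod) (auto simp: prod_norm[symmetric] intro!: prod_mono bump1_fourier_decay)
qed

lemma bump_decay_integral_finite: "(\<integral>\<^sup>+w. ennreal (bump_decay (w :: 'a::euclidean_space)) \<partial>lborel) < \<infinity>"
proof -
  have "integrable lborel (\<lambda>x::real. inverse (1 + x\<^sup>2))"
    using integrable_inverse_1_plus_square by (simp add: set_integrable_def)
  then have "integrable lborel (\<lambda>x::real. 16 * inverse (1 + x\<^sup>2))"
    by simp
  then have "integrable lborel (\<lambda>x::real. 16 / (1 + x\<^sup>2))"
    by (simp add: divide_inverse)
  then have "integrable lborel (bump_decay :: 'a \<Rightarrow> real)"
    unfolding bump_decay_def[abs_def] by (intro integrable_lborel_prod)
  then show ?thesis
    by (simp add: integrable_iff_bounded abs_of_nonneg[OF bump_decay_nonneg])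
qed

text \<open>The two powers of \<open>r\<close> balance: the mass of the bump is of order r^m, while
  the majorant of its Fourier integral has an L1 norm independent of \<open>r\<close>.\<close>

lemma
  fixes t0 w :: "'a::euclidean_space"
  assumes "r > 0"
  shows integrable_scaled_bump: "integrable lborel (\<lambda>t. bump ((t - t0) /\<^sub>R r))"
    and integral_scaled_bump: "(LINT t|lborel. bump ((t - t0) /\<^sub>R r)) = r ^ DIM('a) * (4 / 3) ^ DIM('a)"
    and scaled_bump_fourier_decay:
      "norm (LINT t|lborel. complex_of_real (bump ((t - t0) /\<^sub>R r)) * cis (w \<bullet> t)) \<le>
        r ^ DIM('a) * bump_decay (r *\<^sub>R w)"
proof -
  show "integrable lborel (\<lambda>t. bump ((t - t0) /\<^sub>R r))"
    using integrable_lborel_affine[OF integrable_bump, of "1 / r" "- (t0 /\<^sub>R r)"] assms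
    by (simp add: divide_inverse algebra_simps)
  show "(LINT t|lborel. bump ((t - t0) /\<^sub>R r)) = r ^ DIM('a) * (4 / 3) ^ DIM('a)"
    using assms by (subst integral_lborel_affine[where c=r and t=t0]) (simp_all add: integral_bump)
  have "(LINT t|lborel. complex_of_real (bump ((t - t0) /\<^sub>R r)) * cis (w \<bullet> t)) =
      r ^ DIM('a) *\<^sub>R (LINT x|lborel. cis (w \<bullet> t0) * (complex_of_real (bump x) * cis ((r *\<^sub>R w) \<bullet> x)))"
    using assms by (subst integral_lborel_affine[where c=r and t=t0])
      (simp_all add: inner_add_right mult_ac flip: cis_mult)
  also have "\<dots> = r ^ DIM('a) *\<^sub>R (cis (w \<bullet> t0) * (LINT x|lborel. complex_of_real (bump x) * cis ((r *\<^sub>R w) \<bullet> x)))"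
    by (subst integral_mult_right_zero) simp
  finally show "norm (LINT t|lborel. complex_of_real (bump ((t - t0) /\<^sub>R r)) * cis (w \<bullet> t)) \<le>
        r ^ DIM('a) * bump_decay (r *\<^sub>R w)"
    using assms bump_fourier_decay[of "r *\<^sub>R w"] by (simp add: norm_mult mult_left_mono)
qed

section \<open>From averages of |g| to the L^p norm\<close>

text \<open>Jensen's inequality for a weight of mass at most \<open>J\<close>, up to a factor 2^p,
  by cutting at the level \<open>\<tau>\<close>. Values of |g| below \<open>\<tau>\<close>
  contribute at most \<open>\<tau> * J\<close>, half of \<open>a\<close>; above it |g| is at most
  \<tau>^(1-p) |g|^p.\<close>

lemma weighted_power_lower_bound:
  fixes g :: "'a::euclidean_space \<Rightarrow> complex"
  assumes p: "1 \<le> p" and [measurable]: "g \<in> borel_measurable borel" "K \<in> borel_measurable borel"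
    and K0: "\<And>v. 0 \<le> K v" and KJ: "(\<integral>\<^sup>+v. ennreal (K v) \<partial>lborel) \<le> ennreal J" and "J > 0" "a > 0"
    and a: "ennreal a \<le> (\<integral>\<^sup>+v. ennreal (norm (g v) * K v) \<partial>lborel)"
  shows "ennreal ((a / (2 * J)) powr (p - 1) * (a / 2)) \<le> (\<integral>\<^sup>+v. ennreal (norm (g v) powr p * K v) \<partial>lborel)"
proof -
  define \<tau> where "\<tau> = a / (2 * J)"
  have \<tau>: "\<tau> > 0" using assms by (simp add: \<tau>_def)
  let ?X = "\<integral>\<^sup>+v. ennreal (norm (g v) powr p * K v) \<partial>lborel"
  have pw: "\<tau> powr (p - 1) * y \<le> \<tau> powr p + y powr p" if "0 \<le> y" for y
  proof (cases "y \<le> \<tau>")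
    case True
    then have "\<tau> powr (p - 1) * y \<le> \<tau> powr (p - 1) * \<tau>"
      by (intro mult_left_mono) auto
    also have "\<dots> = \<tau> powr p" using \<tau> by (simp add: powr_diff)
    finally show ?thesis by (simp add: add_increasing2)
  next
    case False
    then have "\<tau> powr (p - 1) * y \<le> y powr (p - 1) * y"
      using p \<tau> by (intro mult_right_mono powr_mono2) auto
    also have "\<dots> = y powr p" using False \<tau> by (simp add: powr_diff)
    finally show ?thesis by (simp add: add_increasing)
  qed
  have "ennreal (\<tau> powr (p - 1) * a) \<le> ennreal (\<tau> powr (p - 1)) * (\<integral>\<^sup>+v. ennreal (norm (g v) * K v) \<partial>lborel)"
    using a \<open>a > 0\<close> by (simp add: ennreal_mult mult_left_mono)
  also have "\<dots> = (\<integral>\<^sup>+v. ennreal (\<tau> powr (p - 1) * (norm (g v) * K v)) \<partial>lborel)"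
    using K0 by (simp add: ennreal_mult nn_integral_cmult)
  also have "\<dots> \<le> (\<integral>\<^sup>+v. ennreal (\<tau> powr p) * ennreal (K v) + ennreal (norm (g v) powr p * K v) \<partial>lborel)"
  proof (intro nn_integral_mono)
    fix v
    have "\<tau> powr (p - 1) * (norm (g v) * K v) \<le> \<tau> powr p * K v + norm (g v) powr p * K v"
      using mult_right_mono[OF pw[of "norm (g v)"] K0[of v]] by (simp add: algebra_simps)
    then show "ennreal (\<tau> powr (p - 1) * (norm (g v) * K v)) \<le>
        ennreal (\<tau> powr p) * ennreal (K v) + ennreal (norm (g v) powr p * K v)"
      using K0[of v] by (simp flip: ennreal_mult ennreal_plus)
  qed
  also have "\<dots> = ennreal (\<tau> powr p) * (\<integral>\<^sup>+v. ennreal (K v) \<partial>lborel) + ?X"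
    by (simp add: nn_integral_add nn_integral_cmult)
  also have "\<dots> \<le> ennreal (\<tau> powr p) * ennreal J + ?X"
    by (intro add_right_mono mult_left_mono KJ) auto
  also have "ennreal (\<tau> powr p) * ennreal J = ennreal (\<tau> powr (p - 1) * (a / 2))"
  proof -
    have "ennreal (\<tau> powr p) * ennreal J = ennreal (\<tau> powr p * J)"
      using \<open>J > 0\<close> by (simp add: ennreal_mult)
    also have "\<tau> powr p * J = \<tau> powr (p - 1) * (\<tau> * J)"
      using \<tau> by (simp add: powr_diff)
    also have "\<tau> * J = a / 2"
      using \<open>J > 0\<close> by (simp add: \<tau>_def)
    finally show ?thesis .
  qed
  finally have *: "ennreal (\<tau> powr (p - 1) * a) \<le> ennreal (\<tau> powr (p - 1) * (a / 2)) + ?X" .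
  show ?thesis
  \<comment> \<open>Cancelling half of the left side takes real arithmetic; an infinite integral
    satisfies the bound trivially.\<close>
  proof (cases ?X)
    case (real x)
    then have "\<tau> powr (p - 1) * a \<le> \<tau> powr (p - 1) * (a / 2) + x"
      using * \<open>a > 0\<close> by (simp flip: ennreal_plus)
    then have "\<tau> powr (p - 1) * (a / 2) \<le> x" by simp
    then show ?thesis
      unfolding real(2) \<tau>_def by (rule ennreal_leI)
  next
    case top
    then show ?thesis by simp
  qed
qed

text \<open>The weighted bound is integrated over \<open>S\<close> and the integrals are exchanged.
  The kernel is used with both marginals: mass at most \<open>J\<close> in \<open>v\<close>, and
  mass at most J/|lam|^m in \<open>s\<close>, because its centre \<open>lam *\<^sub>R s\<close>
  moves at speed |lam|. The latter produces the measure of the dilated set without forming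
  it.\<close>

lemma averaged_power_lower_bound:
  fixes g :: "'a::euclidean_space \<Rightarrow> complex"
  assumes p: "1 \<le> p" and [measurable]: "g \<in> borel_measurable borel" "S \<in> sets borel"
    and KJ: "(\<integral>\<^sup>+w. ennreal (bump_decay (w :: 'a)) \<partial>lborel) \<le> ennreal J" and "J > 0" "a > 0"
    and r: "r > 0" and l: "lam \<noteq> 0"
    and a: "\<And>s. s \<in> S \<Longrightarrow> ennreal a \<le>
      (\<integral>\<^sup>+v. ennreal (norm (g v) * (r ^ DIM('a) * bump_decay (r *\<^sub>R (v - lam *\<^sub>R s)))) \<partial>lborel)"
  shows "ennreal ((a / (2 * J)) powr (p - 1) * (a / 2)) * emeasure lborel S * ennreal (\<bar>lam\<bar> ^ DIM('a)) \<le>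
    ennreal J * (\<integral>\<^sup>+v. ennreal (norm (g v) powr p) \<partial>lborel)"
proof -
  define K where "K v s = r ^ DIM('a) * bump_decay (r *\<^sub>R (v - lam *\<^sub>R s))" for v s :: 'a
  have [measurable]: "(\<lambda>x. K (fst x) (snd x)) \<in> borel_measurable (borel \<Otimes>\<^sub>M borel)"
    unfolding K_def by measurable
  have [measurable]: "(\<lambda>v. K v s) \<in> borel_measurable borel" "(\<lambda>s. K v s) \<in> borel_measurable borel" for v s
    unfolding K_def by measurable
  have K0: "0 \<le> K v s" for v s
    using r by (simp add: K_def bump_decay_nonneg)
  have K1: "(\<integral>\<^sup>+v. ennreal (K v s) \<partial>lborel) \<le> ennreal J" for s
  proof -
    have "(\<integral>\<^sup>+w. ennreal (bump_decay (w :: 'a)) \<partial>lborel) =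
        ennreal (r ^ DIM('a)) * (\<integral>\<^sup>+v. ennreal (bump_decay (- (r *\<^sub>R lam *\<^sub>R s) + r *\<^sub>R v)) \<partial>lborel)"
      using r by (subst nn_integral_lborel_affine[where c=r and t="- (r *\<^sub>R lam *\<^sub>R s)"]) auto
    also have "\<dots> = (\<integral>\<^sup>+v. ennreal (K v s) \<partial>lborel)"
      using r by (simp add: K_def ennreal_mult' nn_integral_cmult bump_decay_nonneg scaleR_diff_right)
    finally show ?thesis using KJ by simp
  qed
  have K2: "ennreal (\<bar>lam\<bar> ^ DIM('a)) * (\<integral>\<^sup>+s. ennreal (K v s) \<partial>lborel) \<le> ennreal J" for v
  proof -
    have "(\<integral>\<^sup>+w. ennreal (bump_decay (w :: 'a)) \<partial>lborel) =
        ennreal (\<bar>- (r * lam)\<bar> ^ DIM('a)) * (\<integral>\<^sup>+s. ennreal (bump_decay (r *\<^sub>R v + (- (r * lam)) *\<^sub>R s)) \<partial>lborel)"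
      using r l by (subst nn_integral_lborel_affine[where c="- (r * lam)" and t="r *\<^sub>R v"]) auto
    also have "\<dots> = ennreal (\<bar>lam\<bar> ^ DIM('a)) * (\<integral>\<^sup>+s. ennreal (K v s) \<partial>lborel)"
      using r by (simp add: K_def ennreal_mult' nn_integral_cmult bump_decay_nonneg scaleR_diff_right
        abs_mult power_mult_distrib mult_ac)
    finally show ?thesis using KJ by simp
  qed
  let ?c = "ennreal ((a / (2 * J)) powr (p - 1) * (a / 2))"
  have "?c * emeasure lborel S = (\<integral>\<^sup>+s. ?c * indicator S s \<partial>lborel)"
    by (simp add: nn_integral_cmult)
  also have "\<dots> \<le> (\<integral>\<^sup>+s. (\<integral>\<^sup>+v. ennreal (norm (g v) powr p * K v s) \<partial>lborel) \<partial>lborel)"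
  proof (intro nn_integral_mono)
    fix s
    show "?c * indicator S s \<le> (\<integral>\<^sup>+v. ennreal (norm (g v) powr p * K v s) \<partial>lborel)"
    proof (cases "s \<in> S")
      case True
      have "?c \<le> (\<integral>\<^sup>+v. ennreal (norm (g v) powr p * K v s) \<partial>lborel)"
        using a[OF True] unfolding K_def[symmetric]
        by (intro weighted_power_lower_bound[OF p _ _ K0 K1 \<open>J > 0\<close> \<open>a > 0\<close>]) auto
      then show ?thesis using True by simp
    qed simp
  qed
  also have "\<dots> = (\<integral>\<^sup>+v. (\<integral>\<^sup>+s. ennreal (norm (g v) powr p * K v s) \<partial>lborel) \<partial>lborel)"
    by (rule lborel_pair.Fubini') measurable
  also have "\<dots> = (\<integral>\<^sup>+v. ennreal (norm (g v) powr p) * (\<integral>\<^sup>+s. ennreal (K v s) \<partial>lborel) \<partial>lborel)"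
    using K0 by (simp add: ennreal_mult nn_integral_cmult)
  finally have "?c * emeasure lborel S * ennreal (\<bar>lam\<bar> ^ DIM('a)) \<le>
      (\<integral>\<^sup>+v. ennreal (norm (g v) powr p) * (\<integral>\<^sup>+s. ennreal (K v s) \<partial>lborel) \<partial>lborel) * ennreal (\<bar>lam\<bar> ^ DIM('a))"
    by (rule mult_right_mono) simp
  also have "\<dots> = (\<integral>\<^sup>+v. ennreal (norm (g v) powr p) * (ennreal (\<bar>lam\<bar> ^ DIM('a)) * (\<integral>\<^sup>+s. ennreal (K v s) \<partial>lborel)) \<partial>lborel)"
    by (subst nn_integral_multc[symmetric]) (auto simp: mult_ac)
  also have "\<dots> \<le> (\<integral>\<^sup>+v. ennreal (norm (g v) powr p) * ennreal J \<partial>lborel)"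
    by (intro nn_integral_mono mult_left_mono K2) auto
  also have "\<dots> = ennreal J * (\<integral>\<^sup>+v. ennreal (norm (g v) powr p) \<partial>lborel)"
    by (subst nn_integral_multc) (auto simp: mult.commute)
  finally show ?thesis .
qed

section \<open>The pairing near one point\<close>

text \<open>After demodulation the integrand is the bump times a unit number whose phase is at most
  1/2. There is no cancellation, and the pairing is at least half the mass of the bump;
  \<open>pairing_bound\<close> carries this over to \<open>g\<close>.\<close>

lemma local_frequency_lower_bound:
  fixes F g :: "'a::euclidean_space \<Rightarrow> complex" and r :: real
  assumes Ap: "Ap_repr p F g" and p: "1 \<le> p" and V: "open V" "continuous_on V F"
    and F: "\<And>t. t \<in> V \<Longrightarrow> F t = cis (\<psi> t)"
    and r: "r > 0" and sub: "cball t0 (DIM('a) * r) \<subseteq> V"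
    and lin: "\<And>t. t \<in> cball t0 (DIM('a) * r) \<Longrightarrow> \<bar>\<psi> t - \<psi> t0 - u \<bullet> (t - t0)\<bar> \<le> 1 / 2"
  shows "ennreal (r ^ DIM('a) * ((4 / 3) ^ DIM('a) / 2)) \<le>
    (\<integral>\<^sup>+v. ennreal (norm (g v) * (r ^ DIM('a) * bump_decay (r *\<^sub>R (v - u)))) \<partial>lborel)"
proof -
  define b where "b t = bump ((t - t0) /\<^sub>R r)" for t
  have [measurable]: "b \<in> borel_measurable borel"
    unfolding b_def by measurable
  have [measurable]: "F \<in> borel_measurable borel"
    using Ap by (auto simp: Ap_repr_def)
  have b01: "0 \<le> b t" "b t \<le> 1" for t
    by (simp_all add: b_def bump_bounds)
  have b0: "b t = 0" if "t \<notin> cball t0 (DIM('a) * r)" for t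
    unfolding b_def using that r
    by (intro bump_eq_0) (simp add: dist_norm norm_minus_commute[of t0] not_le pos_less_divide_eq
        divide_inverse_commute[symmetric])
  have bi: "integrable lborel b"
    unfolding b_def by (rule integrable_scaled_bump[OF r])
  define k where "k t = complex_of_real (b t) * cis (- (u \<bullet> t))" for t
  have [measurable]: "k \<in> borel_measurable borel"
    unfolding k_def by measurable
  \<comment> \<open>A constant phase, which leaves the norm of the integral unchanged and makes the
    phase of \<open>q\<close> vanish at \<open>t0\<close>.\<close>
  define \<theta> where "\<theta> = \<psi> t0 - u \<bullet> t0"
  define q where "q t = cis (- \<theta>) * (F t * k t)" for t
  have qeq: "q t = complex_of_real (b t) * cis (\<psi> t - \<psi> t0 - u \<bullet> (t - t0))" for t
  proof (cases "t \<in> cball t0 (DIM('a) * r)")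
    case True
    then have "F t = cis (\<psi> t)" using sub F by blast
    then show ?thesis
      by (simp add: q_def k_def \<theta>_def cis_mult inner_diff_right algebra_simps)
  qed (simp add: q_def k_def b0)
  have qi: "integrable lborel q"
  proof (rule Bochner_Integration.integrable_bound[OF bi])
    show "AE t in lborel. norm (q t) \<le> norm (b t)"
      by (simp add: qeq norm_mult)
    show "q \<in> borel_measurable lborel" unfolding q_def by measurable
  qed
  have "b t / 2 \<le> Re (q t)" for t
  proof (cases "t \<in> cball t0 (DIM('a) * r)")
    case True
    define x where "x = \<bar>\<psi> t - \<psi> t0 - u \<bullet> (t - t0)\<bar>"
    \<comment> \<open>The angle pi/3 has cosine 1/2, and 1/2 < pi/3 because pi > 3.\<close>
    have "cos x \<ge> cos (pi / 3)"
      using lin[OF True] pi_gt3 unfolding x_def by (intro cos_monotone_0_pi_le) auto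
    then have "1 / 2 \<le> cos (\<psi> t - \<psi> t0 - u \<bullet> (t - t0))"
      by (simp add: x_def cos_60)
    then show ?thesis
      using b01[of t] mult_left_mono[of "1/2" _ "b t"] by (simp add: qeq)
  qed (simp add: qeq b0)
  then have "(LINT t|lborel. b t / 2) \<le> (LINT t|lborel. Re (q t))"
    using bi qi by (intro integral_mono) auto
  also have "\<dots> \<le> norm (LINT t|lborel. q t)"
    using qi complex_Re_le_cmod by simp
  also have "\<dots> = norm (LINT t|lborel. F t * k t)"
    unfolding q_def by (simp add: norm_mult)
  finally have "r ^ DIM('a) * ((4 / 3) ^ DIM('a) / 2) \<le> norm (LINT t|lborel. F t * k t)"
    using integral_scaled_bump[OF r, of t0] by (simp add: b_def)
  then have "ennreal (r ^ DIM('a) * ((4 / 3) ^ DIM('a) / 2)) \<le> ennreal (norm (LINT t|lborel. F t * k t))"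
    by (rule ennreal_leI)
  also have "\<dots> \<le> (\<integral>\<^sup>+v. ennreal (norm (g v) * norm (LINT t|lborel. k t * cis (v \<bullet> t))) \<partial>lborel)"
    by (rule pairing_bound[OF Ap p V compact_cball sub]) (auto simp: k_def norm_mult b01 b0)
  also have "\<dots> \<le> (\<integral>\<^sup>+v. ennreal (norm (g v) * (r ^ DIM('a) * bump_decay (r *\<^sub>R (v - u)))) \<partial>lborel)"
  proof (intro nn_integral_mono ennreal_leI mult_left_mono)
    fix v
    have "k t * cis (v \<bullet> t) = complex_of_real (bump ((t - t0) /\<^sub>R r)) * cis ((v - u) \<bullet> t)" for t
      by (simp add: k_def b_def cis_mult inner_diff_left)
    then show "norm (LINT t|lborel. k t * cis (v \<bullet> t)) \<le> r ^ DIM('a) * bump_decay (r *\<^sub>R (v - u))"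
      using scaled_bump_fourier_decay[OF r, of t0 "v - u"] by simp
  qed simp
  finally show ?thesis .
qed

section \<open>The gradient of \<open>\<phi>\<close> and the inverse of \<chi>\<close>

text \<open>The class supplies constants for each basis direction separately. Finitely many are
  merged by a sum and a minimum, and positivity of \<open>\<omega>\<close> lets the constant be
  enlarged.\<close>

lemma C1_omega_uniform:
  fixes \<phi> :: "'a::euclidean_space \<Rightarrow> real"
  assumes \<phi>: "C1_omega \<omega> V \<phi>" and pos: "\<And>\<delta>. \<delta> > 0 \<Longrightarrow> \<omega> \<delta> > 0"
  obtains C \<delta>0 where "C > 0" "\<delta>0 > 0"
    "\<And>\<delta> t1 t2 i. 0 < \<delta> \<Longrightarrow> \<delta> \<le> \<delta>0 \<Longrightarrow> t1 \<in> V \<Longrightarrow> t2 \<in> V \<Longrightarrow> dist t1 t2 \<le> \<delta> \<Longrightarrow> i \<in> Basis \<Longrightarrow>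
      \<bar>frechet_derivative \<phi> (at t1) i - frechet_derivative \<phi> (at t2) i\<bar> \<le> C * \<omega> \<delta>"
proof -
  define Q where "Q i C D \<longleftrightarrow> D > 0 \<and> (\<forall>\<delta>. 0 < \<delta> \<and> \<delta> \<le> D \<longrightarrow>
        (\<forall>t1\<in>V. \<forall>t2\<in>V. dist t1 t2 \<le> \<delta> \<longrightarrow>
          \<bar>frechet_derivative \<phi> (at t1) i - frechet_derivative \<phi> (at t2) i\<bar> \<le> C * \<omega> \<delta>))" for i C D
  have "\<forall>i\<in>Basis. \<exists>C D. Q i C D"
    using \<phi> unfolding C1_omega_def Q_def by (rule conjunct2)
  then obtain C D where CD: "\<And>i. i \<in> Basis \<Longrightarrow> Q i (C i) (D i)"
    by metis
  define C' where "C' = (\<Sum>i\<in>Basis. \<bar>C i\<bar>) + 1"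
  define D' where "D' = Min (D ` Basis)"
  have "C' > 0" unfolding C'_def by (simp add: sum_nonneg add_nonneg_pos)
  moreover have "D' > 0" unfolding D'_def using CD by (subst Min_gr_iff) (auto simp: Q_def)
  moreover have "\<bar>frechet_derivative \<phi> (at t1) i - frechet_derivative \<phi> (at t2) i\<bar> \<le> C' * \<omega> \<delta>"
    if "0 < \<delta>" "\<delta> \<le> D'" "t1 \<in> V" "t2 \<in> V" "dist t1 t2 \<le> \<delta>" "i \<in> Basis" for \<delta> t1 t2 i
  proof -
    have "\<delta> \<le> D i"
      using that unfolding D'_def by (meson Min_le finite_Basis finite_imageI imageI order_trans)
    then have "\<bar>frechet_derivative \<phi> (at t1) i - frechet_derivative \<phi> (at t2) i\<bar> \<le> C i * \<omega> \<delta>"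
      using CD[OF that(6)] that unfolding Q_def by blast
    also have "C i \<le> C'"
      using member_le_sum[of i Basis "\<lambda>i. \<bar>C i\<bar>"] that(6) unfolding C'_def by auto
    then have "C i * \<omega> \<delta> \<le> C' * \<omega> \<delta>"
      using pos[OF that(1)] by (intro mult_right_mono) auto
    finally show ?thesis .
  qed
  ultimately show ?thesis by (rule that)
qed

text \<open>Gives compact, hence Borel, gradient images of compact subsets of
  \<open>V\<close>.\<close>

lemma continuous_on_gradient:
  fixes \<phi> :: "'a::euclidean_space \<Rightarrow> real"
  assumes \<phi>: "C1_omega \<omega> V \<phi>" and pos: "\<And>\<delta>. \<delta> > 0 \<Longrightarrow> \<omega> \<delta> > 0"
    and \<omega>: "continuous_on {0..} \<omega>" "\<omega> 0 = 0"
  shows "continuous_on V (gradient \<phi>)"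
proof -
  obtain C \<delta>0 where C: "C > 0" "\<delta>0 > 0"
    "\<And>\<delta> t1 t2 i. 0 < \<delta> \<Longrightarrow> \<delta> \<le> \<delta>0 \<Longrightarrow> t1 \<in> V \<Longrightarrow> t2 \<in> V \<Longrightarrow> dist t1 t2 \<le> \<delta> \<Longrightarrow> i \<in> Basis \<Longrightarrow>
      \<bar>frechet_derivative \<phi> (at t1) i - frechet_derivative \<phi> (at t2) i\<bar> \<le> C * \<omega> \<delta>"
    using C1_omega_uniform[OF \<phi> pos] by metis
  have "continuous_on V (\<lambda>t. frechet_derivative \<phi> (at t) i)" if i: "i \<in> Basis" for i
    unfolding continuous_on_iff
  proof (intro ballI allI impI)
    fix t :: 'a and e :: real assume t: "t \<in> V" and "e > 0"
    then obtain d where d: "d > 0" "\<And>x. x \<in> {0..} \<Longrightarrow> dist x 0 < d \<Longrightarrow> dist (\<omega> x) (\<omega> 0) < e / C"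
      using \<omega>(1) C(1) unfolding continuous_on_iff by (metis atLeast_iff divide_pos_pos order_refl)
    define \<delta> where "\<delta> = min \<delta>0 (d / 2)"
    have \<delta>: "0 < \<delta>" "\<delta> \<le> \<delta>0" "\<delta> < d" using d C by (auto simp: \<delta>_def)
    have "\<omega> \<delta> < e / C"
      using d(2)[of \<delta>] \<delta> \<omega>(2) by (simp add: dist_real_def)
    then have "C * \<omega> \<delta> < e" using C(1) by (simp add: field_simps)
    then show "\<exists>d>0. \<forall>x'\<in>V. dist x' t < d \<longrightarrow>
        dist (frechet_derivative \<phi> (at x') i) (frechet_derivative \<phi> (at t) i) < e"
      using C(3)[OF \<delta>(1,2) _ t _ i] \<delta>(1) unfolding dist_real_def
      by (intro exI[of _ \<delta>]) (meson less_imp_le order_le_less_trans)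
  qed
  then show ?thesis
    unfolding gradient_def by (intro continuous_intros)
qed

text \<open>The mean value inequality for \<open>\<phi>\<close> minus its linear part at
  \<open>t0\<close>. The derivative of that difference has operator norm at most m E, each
  coordinate of \<open>h\<close> being at most \<open>norm h\<close>.\<close>

lemma gradient_taylor_bound:
  fixes \<phi> :: "'a::euclidean_space \<Rightarrow> real" and \<rho> E :: real
  assumes dif: "\<And>s. s \<in> cball t0 \<rho> \<Longrightarrow> \<phi> differentiable (at s)"
    and E: "\<And>s i. s \<in> cball t0 \<rho> \<Longrightarrow> i \<in> Basis \<Longrightarrow>
      \<bar>frechet_derivative \<phi> (at s) i - frechet_derivative \<phi> (at t0) i\<bar> \<le> E"
    and t: "t \<in> cball t0 \<rho>"
  shows "\<bar>\<phi> t - \<phi> t0 - gradient \<phi> t0 \<bullet> (t - t0)\<bar> \<le> DIM('a) * E * \<rho>"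
proof -
  have \<rho>: "0 \<le> \<rho>" using t zero_le_dist[of t0 t] unfolding mem_cball by linarith
  have t0: "t0 \<in> cball t0 \<rho>" using \<rho> by simp
  have E0: "0 \<le> E" using E[OF t0, of "SOME i. i \<in> Basis"] some_in_eq[of "Basis :: 'a set"] by simp
  let ?D = "\<lambda>s h. frechet_derivative \<phi> (at s) h - gradient \<phi> t0 \<bullet> h"
  have exp: "frechet_derivative \<phi> (at s) h = (\<Sum>i\<in>Basis. (h \<bullet> i) * frechet_derivative \<phi> (at s) i)"
    if "s \<in> cball t0 \<rho>" for s h
  proof -
    have lin: "linear (frechet_derivative \<phi> (at s))"
      using dif[OF that] by (rule linear_frechet_derivative)
    have "frechet_derivative \<phi> (at s) h = frechet_derivative \<phi> (at s) (\<Sum>i\<in>Basis. (h \<bullet> i) *\<^sub>R i)"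
      by (simp add: euclidean_representation)
    then show ?thesis
      using lin by (simp add: linear_sum linear_cmul)
  qed
  have der: "((\<lambda>x. \<phi> x - gradient \<phi> t0 \<bullet> x) has_derivative ?D s) (at s within cball t0 \<rho>)"
    if "s \<in> cball t0 \<rho>" for s
    using dif[OF that] by (intro has_derivative_diff has_derivative_inner_right has_derivative_ident)
      (auto simp: frechet_derivative_works intro: has_derivative_at_withinI)
  have "onorm (?D s) \<le> DIM('a) * E" if s: "s \<in> cball t0 \<rho>" for s
  proof (rule onorm_bound)
    fix h
    have "?D s h = (\<Sum>i\<in>Basis. (h \<bullet> i) * (frechet_derivative \<phi> (at s) i - frechet_derivative \<phi> (at t0) i))"
      unfolding exp[OF s, of h] gradient_def
      by (simp add: inner_sum_right right_diff_distrib sum_subtractf inner_commute[of _ h] mult.commute)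
    also have "\<bar>\<dots>\<bar> \<le> (\<Sum>i\<in>(Basis :: 'a set). norm h * E)"
      by (rule order_trans[OF sum_abs], intro sum_mono)
        (auto simp: abs_mult intro!: mult_mono Basis_le_norm E s)
    finally show "norm (?D s h) \<le> DIM('a) * E * norm h"
      by (simp add: mult_ac)
  qed (use E0 in simp)
  then have "norm ((\<phi> t - gradient \<phi> t0 \<bullet> t) - (\<phi> t0 - gradient \<phi> t0 \<bullet> t0)) \<le> DIM('a) * E * norm (t - t0)"
    by (intro differentiable_bound[OF convex_cball der] t t0)
  also have "\<dots> \<le> DIM('a) * E * \<rho>"
    using t E0 by (intro mult_left_mono) (auto simp: dist_norm norm_minus_commute)
  finally show ?thesis
    by (simp add: inner_diff_right algebra_simps)
qed

text \<open>\<open>the_inv_into\<close> means something only on the range of \<chi>, so a preimage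
  must be produced: \<chi> is strictly increasing, and the intermediate value theorem applies. The
  upper bound keeps the radius bounded uniformly in |lam| \<ge> 1.\<close>

lemma chi_inv_properties:
  assumes \<omega>: "continuous_on {0..} \<omega>" "mono_on {0..} \<omega>" "\<And>\<delta>. \<delta> > 0 \<Longrightarrow> \<omega> \<delta> > 0" and y: "y > 0"
  shows "chi_inv \<omega> y > 0" "chi_inv \<omega> y * \<omega> (chi_inv \<omega> y) = y" "chi_inv \<omega> y \<le> max 1 (y / \<omega> 1)"
proof -
  let ?f = "\<lambda>d. d * \<omega> d"
  have less: "?f a < ?f b" if "0 \<le> a" "a < b" for a b
  proof -
    have "?f a \<le> a * \<omega> b"
      using that \<omega>(2) by (intro mult_left_mono) (auto simp: mono_on_def)
    also have "\<dots> < ?f b"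
      using that \<omega>(3)[of b] by simp
    finally show ?thesis .
  qed
  have inj: "inj_on ?f {0..}"
    by (rule linorder_inj_onI) (use less in force)+
  \<comment> \<open>Since X \<ge> 1, monotonicity gives \<omega>(X) \<ge> \<omega>(1), so \<chi>(X)
    reaches \<open>y\<close>.\<close>
  define X where "X = max 1 (y / \<omega> 1)"
  have "0 \<le> X" by (simp add: X_def)
  have X: "y \<le> ?f X"
  proof -
    have "y = y / \<omega> 1 * \<omega> 1" using \<omega>(3)[of 1] by simp
    also have "\<dots> \<le> X * \<omega> 1"
      using \<omega>(3)[of 1] by (intro mult_right_mono) (auto simp: X_def)
    also have "\<dots> \<le> X * \<omega> X"
      using \<omega>(2) by (intro mult_left_mono) (auto simp: mono_on_def X_def)
    finally show ?thesis .
  qed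
  have "continuous_on {0..X} ?f"
    by (intro continuous_intros continuous_on_subset[OF \<omega>(1)]) auto
  then obtain d where d: "0 \<le> d" "d \<le> X" "?f d = y"
    using IVT'[of ?f 0 y X] X y \<open>0 \<le> X\<close> by auto
  have "chi_inv \<omega> y = d"
    unfolding chi_inv_def using the_inv_into_f_f[OF inj, of d] d by simp
  then show "chi_inv \<omega> y > 0" "chi_inv \<omega> y * \<omega> (chi_inv \<omega> y) = y" "chi_inv \<omega> y \<le> max 1 (y / \<omega> 1)"
    using d y by (auto simp: X_def intro: le_neq_trans)
qed

text \<open>\<open>V\<close> is a countable union of compact sets, and if all their images were
  null, so would be the image of \<open>V\<close>. A compact \<open>K\<close> is wanted because
  balls of one fixed radius around its points stay in \<open>V\<close>.\<close>

lemma gradient_image_compact: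
  fixes \<phi> :: "'a::euclidean_space \<Rightarrow> real"
  assumes "open V" and cont: "continuous_on V (gradient \<phi>)" and pos: "emeasure lborel (gradient \<phi> ` V) > 0"
  obtains K where "compact K" "K \<subseteq> V" "compact (gradient \<phi> ` K)" "emeasure lborel (gradient \<phi> ` K) > 0"
proof -
  obtain C :: "nat \<Rightarrow> 'a set" where C: "\<And>n. compact (C n)" "\<And>n. C n \<subseteq> V" "\<Union>(range C) = V"
    using open_Union_compact_subsets[OF \<open>open V\<close>] by metis
  have cpt: "compact (gradient \<phi> ` C n)" for n
    using compact_continuous_image[OF continuous_on_subset[OF cont C(2)] C(1)] .
  have "\<exists>n. emeasure lborel (gradient \<phi> ` C n) \<noteq> 0"
  proof (rule ccontr)
    assume "\<not> ?thesis"
    then have "(\<Union>n. gradient \<phi> ` C n) \<in> null_sets lborel"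
      using cpt by (intro null_sets_UN) (auto simp: null_sets_def borel_compact)
    moreover have "(\<Union>n. gradient \<phi> ` C n) = gradient \<phi> ` V"
      using C(3) by blast
    ultimately show False using pos by (simp add: null_sets_def)
  qed
  then obtain n where "emeasure lborel (gradient \<phi> ` C n) \<noteq> 0" ..
  then show ?thesis
    using C(1,2) cpt by (intro that[of "C n"]) (auto simp: zero_less_iff_neq_zero)
qed

section \<open>Choice of the constants and the final estimate\<close>

theorem mainTheorem5:
  fixes p :: real and \<omega> :: "real \<Rightarrow> real" and V :: "'a::euclidean_space set"
    and \<phi> :: "'a \<Rightarrow> real"
  assumes "1 \<le> p" "p < 2"
    and "continuous_on {0..} \<omega>" "mono_on {0..} \<omega>" "\<omega> 0 = 0"
    and "\<forall>\<delta>>0. \<omega> \<delta> > 0"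
    and "open V" "connected V" "V \<noteq> {}"
    and "C1_omega \<omega> V \<phi>"
    and "emeasure lborel (gradient \<phi> ` V) > 0"
  shows "\<exists>c>0. \<forall>lam::real. \<bar>lam\<bar> \<ge> 1 \<and> in_Ap_restr p V (\<lambda>t. cis (lam * \<phi> t)) \<longrightarrow>
           Ap_restr_norm p V (\<lambda>t. cis (lam * \<phi> t))
             \<ge> c * (\<bar>lam\<bar> powr (1 / p) * chi_inv \<omega> (1 / \<bar>lam\<bar>)) ^ DIM('a)"
proof -
  note p = \<open>1 \<le> p\<close> and V = \<open>open V\<close>
  have \<omega>pos: "\<omega> \<delta> > 0" if "\<delta> > 0" for \<delta> using assms(6) that by simp
  obtain C \<delta>0 where C: "C > 0" and \<delta>0: "\<delta>0 > 0"
    and CE: "\<And>\<delta> t1 t2 i. 0 < \<delta> \<Longrightarrow> \<delta> \<le> \<delta>0 \<Longrightarrow> t1 \<in> V \<Longrightarrow> t2 \<in> V \<Longrightarrow> dist t1 t2 \<le> \<delta> \<Longrightarrow> i \<in> Basis \<Longrightarrow>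
      \<bar>frechet_derivative \<phi> (at t1) i - frechet_derivative \<phi> (at t2) i\<bar> \<le> C * \<omega> \<delta>"
    using C1_omega_uniform[OF assms(10) \<omega>pos] by metis
  have dif: "\<phi> differentiable (at s)" if "s \<in> V" for s
    using assms(10) V that unfolding C1_omega_def by (simp add: differentiable_on_eq_differentiable_at)
  obtain K where K: "compact K" "K \<subseteq> V" and S: "compact (gradient \<phi> ` K)" "emeasure lborel (gradient \<phi> ` K) > 0"
    using gradient_image_compact[OF V continuous_on_gradient[OF assms(10) \<omega>pos assms(3,5)] assms(11)] by metis
  define \<mu> where "\<mu> = measure lborel (gradient \<phi> ` K)"
  have \<mu>: "emeasure lborel (gradient \<phi> ` K) = ennreal \<mu>"
    unfolding \<mu>_def using emeasure_compact_finite[OF S(1)] by (intro emeasure_eq_ennreal_measure) auto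
  have \<mu>0: "\<mu> > 0" using S(2) unfolding \<mu> by simp
  have SB: "gradient \<phi> ` K \<in> sets borel" using S(1) by (rule borel_compact)
  obtain \<epsilon> where \<epsilon>: "\<epsilon> > 0" "(\<Union>x\<in>K. cball x \<epsilon>) \<subseteq> V"
    using compact_subset_open_imp_cball_epsilon_subset[OF K(1) V K(2)] by metis
  let ?I = "\<integral>\<^sup>+w. ennreal (bump_decay (w :: 'a)) \<partial>lborel"
  define J where "J = enn2real ?I + 1"
  have J0: "J > 0" by (simp add: J_def add_nonneg_pos)
  have J: "?I \<le> ennreal J"
  proof -
    have "?I = ennreal (enn2real ?I)" using bump_decay_integral_finite[where 'a='a] by (simp add: less_top)
    also have "\<dots> \<le> ennreal J" by (intro ennreal_leI) (simp add: J_def)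
    finally show ?thesis .
  qed
  define n where "n = DIM('a)"
  have n: "n > 0" by (simp add: n_def)
  \<comment> \<open>Bounds \<open>\<delta>\<close> for every |lam| \<ge> 1 at once.\<close>
  define D where "D = max 1 (1 / \<omega> 1)"
  have D: "D > 0" by (simp add: D_def)
  \<comment> \<open>The linearization radius will be \<open>\<kappa> * \<delta>\<close>. The four
    entries keep it below \<open>\<delta>\<close>, keep the balls in \<open>V\<close>, stay in the
    range of the modulus estimate, and hold the phase error to 1/2. Dividing by \<open>D\<close>
    instead of \<open>\<delta>\<close> makes \<open>\<kappa>\<close> independent of
    \<open>lam\<close>.\<close>
  define \<kappa> where "\<kappa> = Min {1, \<epsilon> / D, \<delta>0 / D, 1 / (2 * n * C)}"
  have \<kappa>0: "\<kappa> > 0" using \<epsilon>(1) \<delta>0 C D n by (simp add: \<kappa>_def)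
  have \<kappa>: "\<kappa> \<le> 1" "\<kappa> \<le> \<epsilon> / D" "\<kappa> \<le> \<delta>0 / D" "\<kappa> \<le> 1 / (2 * n * C)"
    by (auto simp: \<kappa>_def)
  \<comment> \<open>Half the integral of the bump at unit scale.\<close>
  define A where "A = (4 / 3 :: real) ^ n / 2"
  have A: "A > 0" by (simp add: A_def)
  \<comment> \<open>What \<open>averaged_power_lower_bound\<close> leaves once the powers of
    \<open>r\<close> and |lam| are factored out.\<close>
  define B where "B = (A / (2 * J)) powr (p - 1) * (A / 2) * \<mu> / J"
  have B: "B > 0" using A J0 \<mu>0 by (simp add: B_def)
  define c where "c = B powr (1 / p) * (\<kappa> / n) ^ n"
  have c: "c > 0" using B \<kappa>0 n by (simp add: c_def)
  have main: "c * (\<bar>lam\<bar> powr (1 / p) * chi_inv \<omega> (1 / \<bar>lam\<bar>)) ^ n \<le> Lp_norm p g"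
    if lam: "\<bar>lam\<bar> \<ge> 1" and Ap: "Ap_repr p F g" and F: "\<And>t. t \<in> V \<Longrightarrow> F t = cis (lam * \<phi> t)" for lam F g
  proof -
    define \<delta> where "\<delta> = chi_inv \<omega> (1 / \<bar>lam\<bar>)"
    have \<delta>: "\<delta> > 0" "\<delta> * \<omega> \<delta> = 1 / \<bar>lam\<bar>" "\<delta> \<le> max 1 ((1 / \<bar>lam\<bar>) / \<omega> 1)"
      using chi_inv_properties[OF assms(3,4) \<omega>pos, of "1 / \<bar>lam\<bar>"] lam unfolding \<delta>_def by auto
    have "(1 / \<bar>lam\<bar>) / \<omega> 1 \<le> 1 / \<omega> 1"
      using lam \<omega>pos[of 1] by (intro divide_right_mono) auto
    then have \<delta>D: "\<delta> \<le> D" using \<delta>(3) by (simp add: D_def)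
    \<comment> \<open>The bump at scale \<open>r\<close> is supported in a ball of radius
      \<open>n * r\<close>, so \<open>r\<close> is the linearization radius divided by
      \<open>n\<close>.\<close>
    define \<rho> where "\<rho> = \<kappa> * \<delta>"
    define r where "r = \<rho> / n"
    have \<rho>0: "\<rho> > 0" and r0: "r > 0" using \<kappa>0 \<delta>(1) n by (simp_all add: \<rho>_def r_def)
    have \<rho>D: "\<rho> \<le> \<kappa> * D" unfolding \<rho>_def using \<kappa>0 \<delta>D by simp
    have \<rho>: "\<rho> \<le> \<epsilon>" "\<rho> \<le> \<delta>0" "\<rho> \<le> \<delta>"
      using order_trans[OF \<rho>D] \<kappa>(1-3) \<kappa>0 D \<delta>(1)
      by (auto simp: pos_le_divide_eq) (simp add: \<rho>_def mult_left_le_one_le)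
    have nr: "real DIM('a) * r = \<rho>" using n by (simp add: r_def n_def)
    \<comment> \<open>For p > 1 an extension is only known to be measurable; on \<open>V\<close> it
      inherits continuity from the function it extends.\<close>
    have "continuous_on V \<phi>"
      using assms(10) by (auto simp: C1_omega_def intro: differentiable_imp_continuous_on)
    then have "continuous_on V (\<lambda>t. cis (lam * \<phi> t))"
      by (intro continuous_intros)
    then have contF: "continuous_on V F"
      using F by (simp cong: continuous_on_cong)
    have [measurable]: "g \<in> borel_measurable borel" and gp: "integrable lborel (\<lambda>u. norm (g u) powr p)"
      using Ap by (auto simp: Ap_repr_def)
    have freq: "ennreal (r ^ n * A) \<le>
      (\<integral>\<^sup>+v. ennreal (norm (g v) * (r ^ DIM('a) * bump_decay (r *\<^sub>R (v - lam *\<^sub>R s)))) \<partial>lborel)"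
      if s: "s \<in> gradient \<phi> ` K" for s
    proof -
      obtain t0 where t0: "t0 \<in> K" "s = gradient \<phi> t0" using s by blast
      have sub: "cball t0 \<rho> \<subseteq> V"
        using \<epsilon>(2) t0(1) subset_cball[OF \<rho>(1), of t0] by blast
      have "\<bar>lam * \<phi> t - lam * \<phi> t0 - (lam *\<^sub>R s) \<bullet> (t - t0)\<bar> \<le> 1 / 2" if t: "t \<in> cball t0 \<rho>" for t
      proof -
        have "\<bar>\<phi> t - \<phi> t0 - gradient \<phi> t0 \<bullet> (t - t0)\<bar> \<le> DIM('a) * (C * \<omega> \<delta>) * \<rho>"
        proof (rule gradient_taylor_bound[OF dif _ t])
          fix x and i :: 'a assume x: "x \<in> cball t0 \<rho>" and i: "i \<in> Basis"
          have "\<bar>frechet_derivative \<phi> (at x) i - frechet_derivative \<phi> (at t0) i\<bar> \<le> C * \<omega> \<rho>"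
            using x sub t0(1) K(2) i by (intro CE \<rho>0 \<rho>(2)) (auto simp: dist_commute)
          also have "\<dots> \<le> C * \<omega> \<delta>"
            using assms(4) \<rho>(3) \<rho>0 C by (intro mult_left_mono) (auto simp: mono_on_def)
          finally show "\<bar>frechet_derivative \<phi> (at x) i - frechet_derivative \<phi> (at t0) i\<bar> \<le> C * \<omega> \<delta>" .
        qed (use sub in blast)
        \<comment> \<open>Grouped so that \<chi>(\<delta>) appears, which equals 1/|lam| by the
          choice of \<open>\<delta>\<close>.\<close>
        also have "\<dots> = n * C * \<kappa> * (\<delta> * \<omega> \<delta>)"
          by (simp add: n_def \<rho>_def)
        also have "\<dots> \<le> 1 / 2 * (1 / \<bar>lam\<bar>)"
          unfolding \<delta>(2) using \<kappa>(4) C n by (intro mult_right_mono) (auto simp: field_simps)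
        finally have "\<bar>lam\<bar> * \<bar>\<phi> t - \<phi> t0 - gradient \<phi> t0 \<bullet> (t - t0)\<bar> \<le> \<bar>lam\<bar> * (1 / 2 * (1 / \<bar>lam\<bar>))"
          by (rule mult_left_mono) simp
        moreover have "\<bar>lam\<bar> * (1 / 2 * (1 / \<bar>lam\<bar>)) = 1 / 2" using lam by auto
        moreover have "lam * \<phi> t - lam * \<phi> t0 - (lam *\<^sub>R s) \<bullet> (t - t0) = lam * (\<phi> t - \<phi> t0 - gradient \<phi> t0 \<bullet> (t - t0))"
          by (simp add: t0(2) algebra_simps)
        ultimately show ?thesis by (simp only: abs_mult)
      qed
      then show ?thesis
        using local_frequency_lower_bound[OF Ap p V contF F r0, of t0 "lam *\<^sub>R s"] sub
        unfolding nr A_def n_def by blast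
    qed
    define N where "N = (LINT u|lborel. norm (g u) powr p)"
    have N: "(\<integral>\<^sup>+u. ennreal (norm (g u) powr p) \<partial>lborel) = ennreal N"
      unfolding N_def by (rule nn_integral_eq_integral[OF gp]) simp
    have N0: "N \<ge> 0" by (simp add: N_def)
    have "ennreal ((r ^ n * A / (2 * J)) powr (p - 1) * (r ^ n * A / 2)) * ennreal \<mu> * ennreal (\<bar>lam\<bar> ^ n) \<le> ennreal J * ennreal N"
      using averaged_power_lower_bound[OF p _ SB J J0 _ r0 _ freq] A r0 lam
      unfolding N \<mu> n_def by auto
    then have *: "(r ^ n * A / (2 * J)) powr (p - 1) * (r ^ n * A / 2) * \<mu> * \<bar>lam\<bar> ^ n \<le> J * N"
      using J0 N0 \<mu>0 A r0 by (simp flip: ennreal_mult)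
    \<comment> \<open>The exponents p - 1 and 1 of r^n add up to p, so the later p-th root returns
      exactly r^n.\<close>
    have eq: "(r ^ n * A / (2 * J)) powr (p - 1) * (r ^ n * A / 2) = (r ^ n) powr p * ((A / (2 * J)) powr (p - 1) * (A / 2))"
    proof -
      have "(r ^ n * A / (2 * J)) powr (p - 1) = (r ^ n) powr (p - 1) * (A / (2 * J)) powr (p - 1)"
        using r0 A J0 by (subst powr_mult[symmetric]) auto
      moreover have "(r ^ n) powr p = (r ^ n) powr (p - 1) * r ^ n"
        using r0 by (simp add: powr_diff)
      ultimately show ?thesis by simp
    qed
    have "(r ^ n) powr p * \<bar>lam\<bar> ^ n * B * J \<le> N * J"
      using *[unfolded eq] J0 by (simp add: B_def mult_ac)
    then have "(r ^ n) powr p * \<bar>lam\<bar> ^ n * B \<le> N"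
      using J0 by simp
    then have "((r ^ n) powr p * \<bar>lam\<bar> ^ n * B) powr (1 / p) \<le> N powr (1 / p)"
      using p B r0 by (intro powr_mono2) auto
    also have "((r ^ n) powr p * \<bar>lam\<bar> ^ n * B) powr (1 / p) = r ^ n * (\<bar>lam\<bar> ^ n) powr (1 / p) * B powr (1 / p)"
      using p B r0 by (simp add: powr_mult powr_powr)
    also have "(\<bar>lam\<bar> ^ n) powr (1 / p) = (\<bar>lam\<bar> powr (1 / p)) ^ n"
      using lam by (simp add: powr_powr mult.commute flip: powr_realpow)
    also have "r ^ n * (\<bar>lam\<bar> powr (1 / p)) ^ n * B powr (1 / p) = c * (\<bar>lam\<bar> powr (1 / p) * \<delta>) ^ n"
      by (simp add: c_def r_def \<rho>_def power_mult_distrib power_divide)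
    finally show ?thesis
      unfolding Lp_norm_def N_def \<delta>_def .
  qed
  have "Ap_restr_norm p V (\<lambda>t. cis (lam * \<phi> t)) \<ge> c * (\<bar>lam\<bar> powr (1 / p) * chi_inv \<omega> (1 / \<bar>lam\<bar>)) ^ n"
    if "\<bar>lam\<bar> \<ge> 1" "in_Ap_restr p V (\<lambda>t. cis (lam * \<phi> t))" for lam
    unfolding Ap_restr_norm_def
  \<comment> \<open>A lower bound passes to the infimum of a nonempty set; nonemptiness is what
    \<open>in_Ap_restr\<close> supplies.\<close>
  proof (rule cInf_greatest)
    show "{Lp_norm p g |F g. Ap_repr p F g \<and> (\<forall>t\<in>V. F t = cis (lam * \<phi> t))} \<noteq> {}"
      using that(2) unfolding in_Ap_restr_def by blast
  qed (use main[OF that(1)] in blast)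
  then show ?thesis
    using c unfolding n_def by blast
qed

end
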